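(* If there exists a pair of cardinals $\kappa\le\delta$ such that $\kappa$ is cardinal correct extendible pushing up $\delta$, then $\mathrm{SULST}(\mathcal L(I))$ exists and is at most $\delta$.
   Context: $\mathcal L(I)$ is first-order logic augmented with the Härtig (equicardinality) quantifier: $Ixy\,\varphi(x)\psi(y)$ holds iff the sets defined by $\varphi$ and $\psi$ have the same cardinality. A transitive model $M$ is cardinal correct if every $\gamma$ that $M$ believes to be a cardinal is a cardinal in $V$. For $\kappa\le\delta$, $\kappa$ is cardinal correct extendible pushing up $\delta$ if for every $\alpha>\delta$ there is an elementary embedding $j:V_\alpha\to M$ with $M$ transitive and cardinal correct, critical point $\kappa$, and $j(\delta)>\alpha$. $\mathrm{SULST}(\mathcal L)$ is the least cardinal $\delta$ such that for every language $\tau$, every $\tau$-structure $M$ of size $\gamma\ge\delta$ and every cardinal $\bar\gamma>\gamma$ there is a $\tau$-structure $\bar M$ of size $\ge\bar\gamma$ with $M$ an $\mathcal L$-elementary substructure of $\bar M$. *)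

theory Defs
  imports Main "HOL-Library.Equipollence"
begin

section \<open>The set-theoretic universe\<close>

text \<open>The universe V of ZFC is a type of class \<open>zfc\<close>: \<open>elts x\<close> is the collection of
  elements of the set \<open>x\<close>.  Separation and replacement are stated for arbitrary HOL predicates and
  functions; the axiom of choice is then a consequence of Hilbert choice and replacement.\<close>

class zfc =
  fixes elts :: "'a \<Rightarrow> 'a set"
  assumes extensionality: "elts x = elts y \<Longrightarrow> x = y"
    and foundation: "wf {(x, y). x \<in> elts y}"
    and pairing: "\<exists>z. elts z = {x, y}"
    and union: "\<exists>y. elts y = (\<Union>z\<in>elts x. elts z)"
    and powerset: "\<exists>y. elts y = {z. elts z \<subseteq> elts x}"
    and infinity: "\<exists>y. (\<exists>z\<in>elts y. elts z = {}) \<and>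
                       (\<forall>z\<in>elts y. \<exists>w\<in>elts y. elts w = insert z (elts z))"
    and separation: "\<exists>y. elts y = {z \<in> elts x. P z}"
    and replacement: "\<exists>y. elts y = f ` elts x"

text \<open>Meaningful only if \<open>A\<close> is the extension of a set.\<close>
definition vset :: "'v::zfc set \<Rightarrow> 'v" where
  "vset A = (THE x. elts x = A)"

definition transitive_set :: "'v::zfc \<Rightarrow> bool" where
  "transitive_set x \<longleftrightarrow> (\<forall>y\<in>elts x. elts y \<subseteq> elts x)"

definition Ord :: "'v::zfc \<Rightarrow> bool" where
  "Ord x \<longleftrightarrow> transitive_set x \<and> (\<forall>y\<in>elts x. transitive_set y)"

abbreviation ord_less :: "'v::zfc \<Rightarrow> 'v \<Rightarrow> bool" (infix "<\<^sub>o" 50) where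
  "x <\<^sub>o y \<equiv> x \<in> elts y"

abbreviation ord_le :: "'v::zfc \<Rightarrow> 'v \<Rightarrow> bool" (infix "\<le>\<^sub>o" 50) where
  "x \<le>\<^sub>o y \<equiv> x <\<^sub>o y \<or> x = y"

text \<open>By replacement, a HOL bijection between (extensions of) sets is itself given by a set, so
  \<open>\<approx>\<close> is equinumerosity in V.\<close>
definition Card :: "'v::zfc \<Rightarrow> bool" where
  "Card \<kappa> \<longleftrightarrow> Ord \<kappa> \<and> (\<forall>\<beta>. \<beta> <\<^sub>o \<kappa> \<longrightarrow> \<not> elts \<beta> \<approx> elts \<kappa>)"

definition has_size :: "'v::zfc \<Rightarrow> 'v \<Rightarrow> bool" where
  "has_size x \<gamma> \<longleftrightarrow> Card \<gamma> \<and> elts x \<approx> elts \<gamma>"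

text \<open>The cumulative hierarchy: \<open>V\<^sub>\<alpha>\<close> is the union of the power sets of the \<open>V\<^sub>\<beta>\<close>, \<open>\<beta> < \<alpha>\<close>.\<close>
function Vlevel :: "'v::zfc \<Rightarrow> 'v set" where
  "Vlevel \<alpha> = {x. \<exists>\<beta>\<in>elts \<alpha>. elts x \<subseteq> Vlevel \<beta>}"
  by auto
termination
  by (relation "{(x, y). x \<in> elts y}") (auto simp: foundation)

declare Vlevel.simps [simp del]


section \<open>Elementary embeddings and cardinal correctness\<close>

text \<open>First-order formulas of the language \<open>{\<in>}\<close>.\<close>
datatype set_fm = SMem nat nat | SEq nat nat | SNeg set_fm | SAnd set_fm set_fm | SEx nat set_fm

primrec set_sat :: "'v::zfc set \<Rightarrow> set_fm \<Rightarrow> (nat \<Rightarrow> 'v) \<Rightarrow> bool" where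
  "set_sat A (SMem x y) s \<longleftrightarrow> s x \<in> elts (s y)"
| "set_sat A (SEq x y) s \<longleftrightarrow> s x = s y"
| "set_sat A (SNeg \<phi>) s \<longleftrightarrow> \<not> set_sat A \<phi> s"
| "set_sat A (SAnd \<phi> \<psi>) s \<longleftrightarrow> set_sat A \<phi> s \<and> set_sat A \<psi> s"
| "set_sat A (SEx x \<phi>) s \<longleftrightarrow> (\<exists>a\<in>A. set_sat A \<phi> (s(x := a)))"

definition elementary_embedding :: "('v::zfc \<Rightarrow> 'v) \<Rightarrow> 'v set \<Rightarrow> 'v set \<Rightarrow> bool" where
  "elementary_embedding j A B \<longleftrightarrow> j ` A \<subseteq> B \<and>
     (\<forall>\<phi> s. range s \<subseteq> A \<longrightarrow> (set_sat A \<phi> s \<longleftrightarrow> set_sat B \<phi> (j \<circ> s)))"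

definition critical_point :: "('v::zfc \<Rightarrow> 'v) \<Rightarrow> 'v set \<Rightarrow> 'v \<Rightarrow> bool" where
  "critical_point j A \<kappa> \<longleftrightarrow> Ord \<kappa> \<and> \<kappa> \<in> A \<and> j \<kappa> \<noteq> \<kappa> \<and> (\<forall>\<xi>. \<xi> <\<^sub>o \<kappa> \<longrightarrow> j \<xi> = \<xi>)"

text \<open>Ordered pairs of ordinals, used to code functions between ordinals as sets.  The set
  \<open>{{\<emptyset>}}\<close> is not an ordinal, so the elements \<open>b \<union> {{{\<emptyset>}}}\<close> contributed by the second
  component are never ordinals, and both components can be recovered.

  The pair has to be flat, i.e. not raise (infinite) rank: below, \<open>M\<close> is elementarily equivalent to
  some \<open>V\<^sub>\<alpha>\<close> for arbitrary \<open>\<alpha>\<close>, possibly a successor.  With Kuratowski pairs,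
  \<open>V\<^sub>\<alpha>\<close> for \<open>\<alpha> = \<delta> + 2\<close> contains no bijection between \<open>\<delta>\<close> and \<open>\<delta> + 1\<close> and so would regard
  \<open>\<delta> + 1\<close> as a cardinal; cardinal correct extendibility would be contradictory for this trivial
  reason.  With flat pairs every infinite \<open>V\<^sub>\<alpha>\<close> recognises its cardinals correctly, and for
  limit \<open>\<alpha>\<close> the two codings agree.\<close>
definition flat_pair :: "'v::zfc \<Rightarrow> 'v \<Rightarrow> 'v" where
  "flat_pair \<xi> \<eta> =
     vset (elts \<xi> \<union> (\<lambda>b. vset (insert (vset {vset {vset {}}}) (elts b))) ` elts \<eta>)"

definition is_bijection :: "'v::zfc \<Rightarrow> 'v \<Rightarrow> 'v \<Rightarrow> bool" where
  "is_bijection f \<beta> \<gamma> \<longleftrightarrow>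
     (\<exists>g. bij_betw g (elts \<beta>) (elts \<gamma>) \<and> elts f = (\<lambda>\<xi>. flat_pair \<xi> (g \<xi>)) ` elts \<beta>)"

text \<open>The relativisation to a transitive \<open>M\<close> of the formula \<open>\<gamma> is a cardinal\<close>.  Being an ordinal and
  being a (code of a) bijection are \<open>\<Delta>\<^sub>0\<close>, hence need not be relativised further.\<close>
definition believes_cardinal :: "'v::zfc \<Rightarrow> 'v \<Rightarrow> bool" where
  "believes_cardinal M \<gamma> \<longleftrightarrow> \<gamma> \<in> elts M \<and> Ord \<gamma> \<and>
     \<not> (\<exists>\<beta>\<in>elts \<gamma>. \<exists>f\<in>elts M. is_bijection f \<beta> \<gamma>)"

definition cardinal_correct :: "'v::zfc \<Rightarrow> bool" where
  "cardinal_correct M \<longleftrightarrow> (\<forall>\<gamma>. believes_cardinal M \<gamma> \<longrightarrow> Card \<gamma>)"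

definition cc_extendible_pushing_up :: "'v::zfc \<Rightarrow> 'v \<Rightarrow> bool" where
  "cc_extendible_pushing_up \<kappa> \<delta> \<longleftrightarrow>
     (\<forall>\<alpha>. Ord \<alpha> \<and> \<delta> <\<^sub>o \<alpha> \<longrightarrow>
        (\<exists>j M. transitive_set M \<and> cardinal_correct M \<and>
               elementary_embedding j (Vlevel \<alpha>) (elts M) \<and>
               critical_point j (Vlevel \<alpha>) \<kappa> \<and> \<alpha> <\<^sub>o j \<delta>))"


section \<open>The logic with the Haertig quantifier\<close>

text \<open>Constants are function symbols of arity 0.  Arities outside the symbol sets, and
  interpretations outside the domain or at the wrong number of arguments, are irrelevant.\<close>

record 'v language =
  rel_syms :: 'v
  rel_arity :: "'v \<Rightarrow> nat"
  fun_syms :: 'v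
  fun_arity :: "'v \<Rightarrow> nat"

record 'v struc =
  dom :: 'v
  rel_int :: "'v \<Rightarrow> 'v list \<Rightarrow> bool"
  fun_int :: "'v \<Rightarrow> 'v list \<Rightarrow> 'v"

definition is_struc :: "'v::zfc language \<Rightarrow> 'v struc \<Rightarrow> bool" where
  "is_struc \<tau> S \<longleftrightarrow> elts (dom S) \<noteq> {} \<and>
     (\<forall>f\<in>elts (fun_syms \<tau>). \<forall>as. length as = fun_arity \<tau> f \<and> set as \<subseteq> elts (dom S) \<longrightarrow>
        fun_int S f as \<in> elts (dom S))"

datatype 'v tm = Var nat | Fn 'v "'v tm list"

datatype 'v fm =
    Eq "'v tm" "'v tm"
  | Rel 'v "'v tm list"
  | Neg "'v fm"
  | And "'v fm" "'v fm"
  | Ex nat "'v fm"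
  | Hartig nat nat "'v fm" "'v fm"

fun is_tm :: "'v::zfc language \<Rightarrow> 'v tm \<Rightarrow> bool" where
  "is_tm \<tau> (Var x) \<longleftrightarrow> True"
| "is_tm \<tau> (Fn f ts) \<longleftrightarrow> f \<in> elts (fun_syms \<tau>) \<and> length ts = fun_arity \<tau> f \<and> (\<forall>t\<in>set ts. is_tm \<tau> t)"

primrec is_fm :: "'v::zfc language \<Rightarrow> 'v fm \<Rightarrow> bool" where
  "is_fm \<tau> (Eq t u) \<longleftrightarrow> is_tm \<tau> t \<and> is_tm \<tau> u"
| "is_fm \<tau> (Rel r ts) \<longleftrightarrow> r \<in> elts (rel_syms \<tau>) \<and> length ts = rel_arity \<tau> r \<and> (\<forall>t\<in>set ts. is_tm \<tau> t)"
| "is_fm \<tau> (Neg \<phi>) \<longleftrightarrow> is_fm \<tau> \<phi>"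
| "is_fm \<tau> (And \<phi> \<psi>) \<longleftrightarrow> is_fm \<tau> \<phi> \<and> is_fm \<tau> \<psi>"
| "is_fm \<tau> (Ex x \<phi>) \<longleftrightarrow> is_fm \<tau> \<phi>"
| "is_fm \<tau> (Hartig x y \<phi> \<psi>) \<longleftrightarrow> is_fm \<tau> \<phi> \<and> is_fm \<tau> \<psi>"

primrec tm_val :: "'v struc \<Rightarrow> (nat \<Rightarrow> 'v) \<Rightarrow> 'v tm \<Rightarrow> 'v" where
  "tm_val S s (Var x) = s x"
| "tm_val S s (Fn f ts) = fun_int S f (map (tm_val S s) ts)"

text \<open>In \<open>Hartig x y \<phi> \<psi>\<close> the quantifier binds \<open>x\<close> in \<open>\<phi>\<close> and \<open>y\<close> in \<open>\<psi>\<close>; all other variables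
  are parameters.\<close>
primrec sat :: "'v::zfc struc \<Rightarrow> 'v fm \<Rightarrow> (nat \<Rightarrow> 'v) \<Rightarrow> bool" where
  "sat S (Eq t u) s \<longleftrightarrow> tm_val S s t = tm_val S s u"
| "sat S (Rel r ts) s \<longleftrightarrow> rel_int S r (map (tm_val S s) ts)"
| "sat S (Neg \<phi>) s \<longleftrightarrow> \<not> sat S \<phi> s"
| "sat S (And \<phi> \<psi>) s \<longleftrightarrow> sat S \<phi> s \<and> sat S \<psi> s"
| "sat S (Ex x \<phi>) s \<longleftrightarrow> (\<exists>a\<in>elts (dom S). sat S \<phi> (s(x := a)))"
| "sat S (Hartig x y \<phi> \<psi>) s \<longleftrightarrow>
     {a \<in> elts (dom S). sat S \<phi> (s(x := a))} \<approx> {b \<in> elts (dom S). sat S \<psi> (s(y := b))}"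

definition substructure :: "'v::zfc language \<Rightarrow> 'v struc \<Rightarrow> 'v struc \<Rightarrow> bool" where
  "substructure \<tau> S T \<longleftrightarrow> is_struc \<tau> S \<and> is_struc \<tau> T \<and> elts (dom S) \<subseteq> elts (dom T) \<and>
     (\<forall>r\<in>elts (rel_syms \<tau>). \<forall>as. length as = rel_arity \<tau> r \<and> set as \<subseteq> elts (dom S) \<longrightarrow>
        (rel_int S r as \<longleftrightarrow> rel_int T r as)) \<and>
     (\<forall>f\<in>elts (fun_syms \<tau>). \<forall>as. length as = fun_arity \<tau> f \<and> set as \<subseteq> elts (dom S) \<longrightarrow>
        fun_int S f as = fun_int T f as)"

definition LI_elementary_substructure :: "'v::zfc language \<Rightarrow> 'v struc \<Rightarrow> 'v struc \<Rightarrow> bool" where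
  "LI_elementary_substructure \<tau> S T \<longleftrightarrow> substructure \<tau> S T \<and>
     (\<forall>\<phi> s. is_fm \<tau> \<phi> \<and> range s \<subseteq> elts (dom S) \<longrightarrow> (sat S \<phi> s \<longleftrightarrow> sat T \<phi> s))"


section \<open>The strong upward Loewenheim--Skolem--Tarski number\<close>

text \<open>A logic enters only through its elementary substructure relation \<open>E\<close>.\<close>

definition SULST_property ::
    "('v::zfc language \<Rightarrow> 'v struc \<Rightarrow> 'v struc \<Rightarrow> bool) \<Rightarrow> 'v \<Rightarrow> bool" where
  "SULST_property E \<delta> \<longleftrightarrow>
     (\<forall>\<tau> S \<gamma> \<gamma>'. is_struc \<tau> S \<and> has_size (dom S) \<gamma> \<and> \<delta> \<le>\<^sub>o \<gamma> \<and> Card \<gamma>' \<and> \<gamma> <\<^sub>o \<gamma>' \<longrightarrow>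
        (\<exists>T \<mu>. is_struc \<tau> T \<and> has_size (dom T) \<mu> \<and> \<gamma>' \<le>\<^sub>o \<mu> \<and> E \<tau> S T))"

definition is_SULST ::
    "('v::zfc language \<Rightarrow> 'v struc \<Rightarrow> 'v struc \<Rightarrow> bool) \<Rightarrow> 'v \<Rightarrow> bool" where
  "is_SULST E \<mu> \<longleftrightarrow> Card \<mu> \<and> SULST_property E \<mu> \<and>
     (\<forall>\<nu>. Card \<nu> \<and> SULST_property E \<nu> \<longrightarrow> \<mu> \<le>\<^sub>o \<nu>)"

end

theory Submission
  imports Defs
begin

text \<open>Given a structure \<open>S\<close> of size \<open>\<gamma> \<ge> \<delta>\<close> and \<open>\<gamma>' > \<gamma>\<close>, choose a limit ordinal \<open>\<alpha> > \<gamma>'\<close> and an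
  elementary embedding \<open>j : V\<^sub>\<alpha> \<rightarrow> M\<close> with \<open>M\<close> cardinal correct and \<open>\<alpha> < j \<delta>\<close>.  Copy \<open>S\<close> to a structure
  on \<open>\<gamma>\<close>; the images under \<open>j\<close> of the graphs of its operations give a structure on \<open>j \<gamma>\<close>.  The symbols
  themselves are not moved, so the language may be arbitrarily large.  Equicardinality of two definable sets is expressed
  in \<open>V\<^sub>\<alpha>\<close> and in \<open>M\<close> by the same first-order formula, "both sets are in bijection with the same
  \<open>k\<close>": every definable set is in bijection, inside the model, with something which the model
  believes to be a cardinal, and these are true cardinals.  Hence every formula with the Haertig
  quantifier has a common first-order translation, and \<open>j\<close> is elementary for it on \<open>\<gamma>\<close>.  Finally
  \<open>j \<gamma>\<close> is believed to be, hence is, a cardinal, and \<open>\<gamma>' < \<alpha> < j \<delta> \<le> j \<gamma>\<close>.\<close>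

section \<open>Uniformly definable predicates\<close>

text \<open>\<open>M\<close> is not assumed to satisfy any set theory: beyond transitivity and
  cardinal correctness, only what \<open>j\<close> carries over from \<open>Vlevel \<alpha>\<close>
  is known about it. So every notion has to be absolute under very weak closure conditions, and
  these conditions have to be transferable themselves. The delicate point is the Haertig quantifier
  in \<open>M\<close>. \<open>Vlevel \<alpha>\<close> contains every subset of \<gamma>, but of the
  subsets of \<open>j \<gamma>\<close> only definable ones are known to be in \<open>M\<close>, and
  they are needed for parameters anywhere in \<open>j \<gamma>\<close>, also outside the range of
  \<open>j\<close>. Hence the claim that an extent is a set with a cardinal is made into a formula,
  closed universally over the parameters, and transferred, once for each translated subformula. This
  forces translation and correctness in both models into a single induction. That \<alpha> is a
  limit leaves room for the few pairing steps above \<gamma> that the codes of graphs and bijections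
  take.\<close>

lemma set_sat_support:
  "\<exists>N. \<forall>(A::'v::zfc set) s t. (\<forall>i<N. s i = t i) \<longrightarrow> set_sat A \<phi> s = set_sat A \<phi> t"
proof (induction \<phi>)
  case (SMem x y)
  show ?case by (rule exI[of _ "Suc (max x y)"]) simp
next
  case (SEq x y)
  show ?case by (rule exI[of _ "Suc (max x y)"]) simp
next
  case (SNeg \<phi>)
  then show ?case by simp
next
  case (SAnd \<phi> \<psi>)
  then obtain M N where
    M: "\<And>(A::'v set) s t. (\<forall>i<M. s i = t i) \<Longrightarrow> set_sat A \<phi> s = set_sat A \<phi> t"
    and N: "\<And>(A::'v set) s t. (\<forall>i<N. s i = t i) \<Longrightarrow> set_sat A \<psi> s = set_sat A \<psi> t"
    by auto
  have "set_sat A (SAnd \<phi> \<psi>) s = set_sat A (SAnd \<phi> \<psi>) t" if "\<forall>i<max M N. s i = t i"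
    for A :: "'v set" and s t
    using M[of s t A] N[of s t A] that by simp
  then show ?case by blast
next
  case (SEx x \<phi>)
  then obtain N where N:
    "\<And>(A::'v set) s t. (\<forall>i<N. s i = t i) \<Longrightarrow> set_sat A \<phi> s = set_sat A \<phi> t"
    by auto
  have *: "set_sat A \<phi> (s(x := a)) = set_sat A \<phi> (t(x := a))" if "\<forall>i<N. s i = t i"
    for A :: "'v set" and s t a
    by (rule N) (use that in auto)
  have "set_sat A (SEx x \<phi>) s = set_sat A (SEx x \<phi>) t" if "\<forall>i<N. s i = t i"
    for A :: "'v set" and s t
    by (simp add: *[OF that])
  then show ?case by blast
qed

text \<open>\<open>f\<close> may identify variables, so under a quantifier the bound variable could
  collide with some \<open>f i\<close>. It is therefore sent to a fresh \<open>N\<close>, which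
  exists because only finitely many variables of the body matter.\<close>

lemma set_sat_rename:
  "\<exists>\<psi>. \<forall>(A::'v::zfc set) s. set_sat A \<psi> s = set_sat A \<phi> (s \<circ> f)"
proof (induction \<phi> arbitrary: f)
  case (SMem x y)
  show ?case by (rule exI[of _ "SMem (f x) (f y)"]) simp
next
  case (SEq x y)
  show ?case by (rule exI[of _ "SEq (f x) (f y)"]) simp
next
  case (SNeg \<phi>)
  then obtain \<psi> where "\<forall>(A::'v set) s. set_sat A \<psi> s = set_sat A \<phi> (s \<circ> f)" by blast
  then show ?case by (intro exI[of _ "SNeg \<psi>"]) (simp add: comp_def)
next
  case (SAnd \<phi> \<psi>)
  obtain \<phi>' where "\<forall>(A::'v set) s. set_sat A \<phi>' s = set_sat A \<phi> (s \<circ> f)"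
    using SAnd.IH(1) by blast
  moreover obtain \<psi>' where "\<forall>(A::'v set) s. set_sat A \<psi>' s = set_sat A \<psi> (s \<circ> f)"
    using SAnd.IH(2) by blast
  ultimately show ?case by (intro exI[of _ "SAnd \<phi>' \<psi>'"]) (simp add: comp_def)
next
  case (SEx x \<phi>)
  obtain K where K:
    "\<And>(A::'v set) s t. (\<forall>i<K. s i = t i) \<Longrightarrow> set_sat A \<phi> s = set_sat A \<phi> t"
    using set_sat_support by blast
  \<comment> \<open>Inserting 0 keeps \<open>Max\<close> meaningful when
    \<open>K = 0\<close>.\<close>
  define N where "N = Suc (Max (insert 0 (f ` {..<K})))"
  have fresh: "f i \<noteq> N" if "i < K" for i
  proof -
    have "f i \<le> Max (insert 0 (f ` {..<K}))" by (rule Max_ge) (use that in auto)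
    then show ?thesis by (simp add: N_def)
  qed
  obtain \<psi> where \<psi>: "\<And>(A::'v set) s. set_sat A \<psi> s = set_sat A \<phi> (s \<circ> f(x := N))"
    using SEx.IH by blast
  have "set_sat A \<phi> (s(N := a) \<circ> f(x := N)) = set_sat A \<phi> ((s \<circ> f)(x := a))"
    for A :: "'v set" and s a
    by (rule K) (use fresh in auto)
  then have "set_sat A (SEx N \<psi>) s = set_sat A (SEx x \<phi>) (s \<circ> f)" for A :: "'v set" and s
    by (simp only: set_sat.simps \<psi>)
  then show ?case by blast
qed

text \<open>Index types other than \<open>nat\<close> allow a quantifier to add the index \<open>None\<close> to the environment,
  so that the closure rules below prove definability by pattern matching.\<close>
definition fmla :: "('v::zfc set \<Rightarrow> ('i \<Rightarrow> 'v) \<Rightarrow> bool) \<Rightarrow> bool" where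
  "fmla P \<longleftrightarrow> (\<exists>\<phi> \<rho>. \<forall>A e. P A e = set_sat A \<phi> (e \<circ> \<rho>))"

lemma fmla_mem: "fmla (\<lambda>A e. e x \<in> elts (e y))"
  unfolding fmla_def by (intro exI[of _ "SMem 0 1"] exI[of _ "\<lambda>n. if n = 0 then x else y"]) simp

lemma fmla_eq: "fmla (\<lambda>A e. e x = e y)"
  unfolding fmla_def by (intro exI[of _ "SEq 0 1"] exI[of _ "\<lambda>n. if n = 0 then x else y"]) simp

lemma fmla_not:
  assumes "fmla P"
  shows "fmla (\<lambda>A e. \<not> P A e)"
proof -
  obtain \<phi> \<rho> where "\<And>A e. P A e = set_sat A \<phi> (e \<circ> \<rho>)"
    using assms unfolding fmla_def by blast
  then have "(\<not> P A e) = set_sat A (SNeg \<phi>) (e \<circ> \<rho>)" for A e by simp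
  then show ?thesis unfolding fmla_def by blast
qed

lemma fmla_reindex:
  assumes "fmla P"
  shows "fmla (\<lambda>A e. P A (\<lambda>i. e (f i)))"
proof -
  obtain \<phi> \<rho> where *: "\<And>A e. P A e = set_sat A \<phi> (e \<circ> \<rho>)"
    using assms unfolding fmla_def by blast
  have "P A (\<lambda>i. e (f i)) = set_sat A \<phi> (e \<circ> (f \<circ> \<rho>))" for A e
    unfolding * by (simp add: comp_def)
  then show ?thesis unfolding fmla_def by blast
qed

text \<open>The two formulas come with unrelated assignments of indices to variables. Moving one to
  the even and the other to the odd variables lets a single assignment serve both.\<close>

lemma fmla_conj:
  assumes "fmla P" "fmla Q"
  shows "fmla (\<lambda>A e. P A e \<and> Q A e)"
proof -
  obtain \<phi> \<rho> where P: "\<And>A e. P A e = set_sat A \<phi> (e \<circ> \<rho>)"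
    using assms(1) unfolding fmla_def by blast
  obtain \<psi> \<sigma> where Q: "\<And>A e. Q A e = set_sat A \<psi> (e \<circ> \<sigma>)"
    using assms(2) unfolding fmla_def by blast
  obtain \<phi>' where \<phi>': "\<And>(A::'a set) s. set_sat A \<phi>' s = set_sat A \<phi> (s \<circ> (\<lambda>i. 2 * i))"
    using set_sat_rename by blast
  obtain \<psi>' where \<psi>': "\<And>(A::'a set) s. set_sat A \<psi>' s = set_sat A \<psi> (s \<circ> (\<lambda>i. 2 * i + 1))"
    using set_sat_rename by blast
  define \<tau> where "\<tau> n = (if even n then \<rho> (n div 2) else \<sigma> (n div 2))" for n
  have "(e \<circ> \<tau>) \<circ> (\<lambda>i. 2 * i) = e \<circ> \<rho>" "(e \<circ> \<tau>) \<circ> (\<lambda>i. 2 * i + 1) = e \<circ> \<sigma>" for e :: "'b \<Rightarrow> 'a"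
    by (auto simp: \<tau>_def)
  then have "(P A e \<and> Q A e) = set_sat A (SAnd \<phi>' \<psi>') (e \<circ> \<tau>)" for A e
    by (simp only: P Q \<phi>' \<psi>' set_sat.simps)
  then show ?thesis unfolding fmla_def by blast
qed

lemma fmla_Bex:
  assumes "fmla (\<lambda>A e. P A (\<lambda>i. e (Some i)) (e None))"
  shows "fmla (\<lambda>A e. \<exists>a\<in>A. P A e a)"
proof -
  obtain \<phi> \<rho> where P: "\<And>A e. P A (\<lambda>i. e (Some i)) (e None) = set_sat A \<phi> (e \<circ> \<rho>)"
    using assms unfolding fmla_def by blast
  define f where "f n = (if \<rho> n = None then 0 else Suc n)" for n
  obtain \<psi> where \<psi>: "\<And>(A::'a set) s. set_sat A \<psi> s = set_sat A \<phi> (s \<circ> f)"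
    using set_sat_rename by blast
  \<comment> \<open>Variable 0 is reserved for the bound element and all others move up by one. The
    value of \<open>\<sigma>\<close> is arbitrary at 0, which the quantifier overwrites, and at
    \<open>Suc n\<close> with \<open>\<rho> n = None\<close>, which is outside the range of
    \<open>f\<close>.\<close>
  define \<sigma> where "\<sigma> n = the (\<rho> (n - 1))" for n
  have "P A e a = set_sat A \<psi> ((e \<circ> \<sigma>)(0 := a))" for A e a
  proof -
    have "(e \<circ> \<sigma>)(0 := a) \<circ> f = case_option a e \<circ> \<rho>"
      by (auto simp: f_def \<sigma>_def fun_eq_iff)
    then show ?thesis using P[of A "case_option a e"] by (simp add: \<psi>)
  qed
  then have "(\<exists>a\<in>A. P A e a) = set_sat A (SEx 0 \<psi>) (e \<circ> \<sigma>)" for A e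
    by simp
  then show ?thesis unfolding fmla_def by blast
qed

lemma fmla_disj: "fmla P \<Longrightarrow> fmla Q \<Longrightarrow> fmla (\<lambda>A e. P A e \<or> Q A e)"
  using fmla_not[OF fmla_conj[OF fmla_not fmla_not], of P Q] by simp

lemma fmla_imp: "fmla P \<Longrightarrow> fmla Q \<Longrightarrow> fmla (\<lambda>A e. P A e \<longrightarrow> Q A e)"
  using fmla_not[OF fmla_conj[OF _ fmla_not], of P Q] by simp

lemma fmla_iff: "fmla P \<Longrightarrow> fmla Q \<Longrightarrow> fmla (\<lambda>A e. P A e \<longleftrightarrow> Q A e)"
  using fmla_conj[OF fmla_imp fmla_imp, of P Q Q P] by (simp add: iff_conv_conj_imp)

lemma fmla_Ball:
  assumes "fmla (\<lambda>A e. P A (\<lambda>i. e (Some i)) (e None))"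
  shows "fmla (\<lambda>A e. \<forall>a\<in>A. P A e a)"
  using fmla_not[OF fmla_Bex[of "\<lambda>A e a. \<not> P A e a"]] fmla_not[OF assms] by simp

lemmas fmla_intros = fmla_mem fmla_eq fmla_not fmla_conj fmla_disj fmla_imp fmla_iff
  fmla_Bex fmla_Ball

text \<open>Together with \<open>fmla_upd\<close>, this lets a given definable \<open>Q\<close>
  occur below quantifiers: after bound variables have been added, the environment passed to
  \<open>Q\<close> has the form \<open>e (r i)\<close> for a nesting \<open>r\<close> of
  \<open>Some\<close>.\<close>

lemma fmla_case_option:
  assumes "fmla Q"
  shows "fmla (\<lambda>A e. Q A (case_option (e k) (\<lambda>i. e (r i))))"
proof -
  have "case_option (e k) (\<lambda>i. e (r i)) = (\<lambda>i. e (case_option k r i))" for e :: "'c \<Rightarrow> 'a"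
    by (auto simp: fun_eq_iff split: option.split)
  then show ?thesis using fmla_reindex[OF assms, of "case_option k r"] by simp
qed

lemma fmla_upd:
  assumes "fmla Q"
  shows "fmla (\<lambda>A e. Q A ((\<lambda>i. e (r i))(x := e k)))"
proof -
  have "(\<lambda>i. e (r i))(x := e k) = (\<lambda>i. e ((r(x := k)) i))" for e :: "'c \<Rightarrow> 'a"
    by (auto simp: fun_eq_iff)
  then show ?thesis using fmla_reindex[OF assms, of "r(x := k)"] by simp
qed

lemma fmla_support:
  assumes "fmla P"
  shows "\<exists>I. finite I \<and> (\<forall>A e e'. (\<forall>i\<in>I. e i = e' i) \<longrightarrow> P A e = P A e')"
proof -
  obtain \<phi> \<rho> where P: "\<And>A e. P A e = set_sat A \<phi> (e \<circ> \<rho>)"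
    using assms unfolding fmla_def by blast
  obtain N where N: "\<And>(A::'a set) s t. (\<forall>i<N. s i = t i) \<Longrightarrow> set_sat A \<phi> s = set_sat A \<phi> t"
    using set_sat_support by blast
  show ?thesis
    by (rule exI[of _ "\<rho> ` {..<N}"]) (auto simp: P intro!: N)
qed

text \<open>Preservation of truth by \<open>j\<close> enters the proof only through this rule;
  whatever is to be moved along \<open>j\<close> is first shown to be \<open>fmla\<close>.\<close>

lemma fmla_transfer:
  assumes "elementary_embedding j A B" "fmla P" "\<And>i. e i \<in> A"
  shows "P A e \<longleftrightarrow> P B (\<lambda>i. j (e i))"
proof -
  obtain \<phi> \<rho> where P: "\<And>A e. P A e = set_sat A \<phi> (e \<circ> \<rho>)"
    using assms(2) unfolding fmla_def by blast
  have "range (e \<circ> \<rho>) \<subseteq> A" using assms(3) by auto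
  then have "set_sat A \<phi> (e \<circ> \<rho>) = set_sat B \<phi> (j \<circ> (e \<circ> \<rho>))"
    using assms(1) unfolding elementary_embedding_def by blast
  then show ?thesis unfolding P by (simp add: comp_def)
qed

section \<open>Sets, ordinals and the cumulative hierarchy\<close>

definition small :: "'v::zfc set \<Rightarrow> bool" where
  "small A \<longleftrightarrow> (\<exists>x. elts x = A)"

lemma elts_inject [simp]: "elts x = elts y \<longleftrightarrow> x = y"
  using extensionality by blast

lemma elts_vset [simp]: "small A \<Longrightarrow> elts (vset A) = A"
proof -
  assume "small A"
  then obtain x where "elts x = A" by (auto simp: small_def)
  then have "vset A = x" by (auto simp: vset_def)
  then show ?thesis by (simp add: \<open>elts x = A\<close>)
qed

lemma vset_elts [simp]: "vset (elts x) = x"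
  by (simp add: vset_def)

lemma small_elts [simp]: "small (elts x)"
  by (auto simp: small_def)

lemma small_pair [simp]: "small {x, y}"
  by (simp add: small_def pairing)

lemma small_singleton [simp]: "small {x}"
  using small_pair[of x x] by simp

lemma small_subset: "small B \<Longrightarrow> A \<subseteq> B \<Longrightarrow> small A"
proof -
  assume "small B" "A \<subseteq> B"
  then obtain x where "B = elts x" by (auto simp: small_def)
  then show "small A" using separation[of x "\<lambda>z. z \<in> A"] \<open>A \<subseteq> B\<close>
    by (auto simp: small_def Collect_conj_eq Int_absorb1)
qed

lemma small_empty [simp]: "small {}"
  using small_subset[OF small_elts] by blast

lemma small_image [simp]:
  fixes f :: "'v::zfc \<Rightarrow> 'v"
  shows "small A \<Longrightarrow> small (f ` A)"
  by (auto simp: small_def replacement)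

lemma small_Union: "small A \<Longrightarrow> small (\<Union>z\<in>A. elts z)"
  by (auto simp: small_def union)

lemma small_UN:
  fixes f :: "'v::zfc \<Rightarrow> 'v set"
  assumes "small A" "\<And>a. a \<in> A \<Longrightarrow> small (f a)"
  shows "small (\<Union>a\<in>A. f a)"
proof -
  have "(\<Union>a\<in>A. f a) = (\<Union>z\<in>(\<lambda>a. vset (f a)) ` A. elts z)"
    using assms(2) by auto
  then show ?thesis using small_Union[OF small_image[OF assms(1)]] by simp
qed

lemma small_Un [simp]: "small A \<Longrightarrow> small B \<Longrightarrow> small (A \<union> B)"
  using small_Union[of "{vset A, vset B}"] by simp

lemma small_insert [simp]: "small A \<Longrightarrow> small (insert x A)"
  using small_Un[of "{x}" A] by simp

lemma small_Pow: "small A \<Longrightarrow> small {x. elts x \<subseteq> A}"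
  by (auto simp: small_def powerset)

lemma vset_inject: "small A \<Longrightarrow> small B \<Longrightarrow> vset A = vset B \<longleftrightarrow> A = B"
  using elts_vset[of A] elts_vset[of B] by metis

section \<open>Foundation and ordinals\<close>

lemma mem_induct [case_names mem]:
  "(\<And>x. (\<And>y. y \<in> elts x \<Longrightarrow> P y) \<Longrightarrow> P x) \<Longrightarrow> P x"
  using wf_induct_rule[OF foundation, of P x] by simp

lemma mem_irrefl [simp]: "x \<notin> elts x"
  by (induction x rule: mem_induct) blast

lemma mem_asym: "x \<in> elts y \<Longrightarrow> y \<notin> elts x"
proof (induction x arbitrary: y rule: mem_induct)
  case (mem x)
  then show ?case by blast
qed

lemma mem_minimal:
  assumes "x \<in> Q"
  shows "\<exists>z\<in>Q. \<forall>y\<in>elts z. y \<notin> Q"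
  using wfE_min[OF foundation assms] by (metis case_prodI mem_Collect_eq)

lemma Ord_mem: "Ord x \<Longrightarrow> y \<in> elts x \<Longrightarrow> Ord y"
  unfolding Ord_def transitive_set_def by blast

lemma Ord_trans: "Ord x \<Longrightarrow> y \<in> elts x \<Longrightarrow> z \<in> elts y \<Longrightarrow> z \<in> elts x"
  by (auto simp: Ord_def transitive_set_def)

lemma Ord_linear: "Ord x \<Longrightarrow> Ord y \<Longrightarrow> x \<in> elts y \<or> x = y \<or> y \<in> elts x"
proof (induction x arbitrary: y rule: mem_induct)
  case (mem x)
  note IHx = mem.IH and \<open>Ord x\<close>[simp]
  show ?case using \<open>Ord y\<close>
  proof (induction y rule: mem_induct)
    case (mem y)
    show ?case
    proof (rule ccontr)
      assume neg: "\<not> ?case"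
      have "z \<in> elts y" if "z \<in> elts x" for z
        using IHx[OF that Ord_mem[OF \<open>Ord x\<close> that] \<open>Ord y\<close>] neg that Ord_trans[OF \<open>Ord x\<close> that] by blast
      moreover have "z \<in> elts x" if "z \<in> elts y" for z
        using mem.IH[OF that Ord_mem[OF \<open>Ord y\<close> that]] neg that Ord_trans[OF \<open>Ord y\<close> that] by blast
      ultimately have "elts x = elts y" by blast
      then show False using neg by simp
    qed
  qed
qed

definition osucc :: "'v::zfc \<Rightarrow> 'v" where
  "osucc x = vset (insert x (elts x))"

lemma elts_osucc [simp]: "elts (osucc x) = insert x (elts x)"
  by (simp add: osucc_def)

lemma Ord_osucc: "Ord x \<Longrightarrow> Ord (osucc x)"
  by (auto simp: Ord_def transitive_set_def)

definition limit_Ord :: "'v::zfc \<Rightarrow> bool" where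
  "limit_Ord \<alpha> \<longleftrightarrow> Ord \<alpha> \<and> elts \<alpha> \<noteq> {} \<and> (\<forall>\<beta>\<in>elts \<alpha>. osucc \<beta> \<in> elts \<alpha>)"

text \<open>The bridge between the HOL type \<open>nat\<close> and the axiom of infinity: iterating
  \<open>osucc\<close> on an element of an inductive set injects \<open>nat\<close> into that set,
  and replacement then reaches the range of any \<open>f\<close>.\<close>

lemma small_range_nat: "small (range (f :: nat \<Rightarrow> 'v::zfc))"
proof -
  obtain y z :: 'v where y: "\<forall>z\<in>elts y. \<exists>w\<in>elts y. elts w = insert z (elts z)"
    and z: "z \<in> elts y"
    using infinity by metis
  have closed: "osucc x \<in> elts y" if "x \<in> elts y" for x
    using y that by (metis extensionality elts_osucc)
  define g where "g n = (osucc ^^ n) z" for n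
  have gy: "g n \<in> elts y" for n
    by (induction n) (auto simp: g_def z closed)
  have less: "g m \<in> elts (g n)" if "m < n" for m n
    using that by (induction n) (auto simp: g_def less_Suc_eq)
  have "inj g" by (rule injI) (metis less mem_irrefl nat_neq_iff)
  then have "range f = (\<lambda>x. f (inv g x)) ` range g"
    by (simp add: image_image)
  moreover have "small (range g)" using small_subset[OF small_elts[of y]] gy by blast
  ultimately show ?thesis by simp
qed

lemma limit_Ord_above:
  assumes "Ord x"
  obtains \<alpha> where "limit_Ord \<alpha>" "x \<in> elts \<alpha>"
proof -
  define g where "g n = (osucc ^^ n) x" for n
  define \<alpha> where "\<alpha> = vset (\<Union>n. elts (g n))"
  have elts: "elts \<alpha> = (\<Union>n. elts (g n))"
    unfolding \<alpha>_def using small_Union[OF small_range_nat[of g]] by simp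
  have Ord: "Ord (g n)" for n
    by (induction n) (auto simp: g_def assms Ord_osucc)
  have g: "g (Suc n) = osucc (g n)" for n by (simp add: g_def)
  \<comment> \<open>\<open>osucc \<beta>\<close> may be equal to \<open>g n\<close>, hence the index
    \<open>Suc n\<close>.\<close>
  have "osucc \<beta> \<in> elts (g (Suc n))" if "\<beta> \<in> elts (g n)" for \<beta> n
  proof -
    have "g n \<notin> elts (osucc \<beta>)"
      using that mem_asym[OF that] by auto
    then show ?thesis
      using Ord_linear[OF Ord_osucc[OF Ord_mem[OF Ord that]] Ord[of n]] by (auto simp: g)
  qed
  then have "\<forall>\<beta>\<in>elts \<alpha>. osucc \<beta> \<in> elts \<alpha>" unfolding elts by blast
  moreover have "x \<in> elts (g 1)" by (simp add: g_def)
  then have "x \<in> elts \<alpha>" unfolding elts by blast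
  moreover have "elts z \<subseteq> elts \<alpha>" if "z \<in> elts \<alpha>" for z
    using that Ord_trans[OF Ord] unfolding elts by blast
  moreover have "transitive_set z" if "z \<in> elts \<alpha>" for z
    using that Ord_mem[OF Ord] unfolding elts Ord_def by blast
  ultimately have "Ord \<alpha>" "\<forall>\<beta>\<in>elts \<alpha>. osucc \<beta> \<in> elts \<alpha>" "x \<in> elts \<alpha>"
    by (simp_all add: Ord_def transitive_set_def[of \<alpha>])
  then show ?thesis using that by (auto simp: limit_Ord_def)
qed

section \<open>The cumulative hierarchy\<close>

lemma mem_Vlevel: "x \<in> Vlevel \<alpha> \<longleftrightarrow> (\<exists>\<beta>\<in>elts \<alpha>. elts x \<subseteq> Vlevel \<beta>)"
  by (subst Vlevel.simps) simp

lemma small_Vlevel: "small (Vlevel \<alpha>)"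
proof (induction \<alpha> rule: mem_induct)
  case (mem \<alpha>)
  have "Vlevel \<alpha> = (\<Union>\<beta>\<in>elts \<alpha>. {x. elts x \<subseteq> Vlevel \<beta>})"
    by (subst Vlevel.simps) blast
  then show ?case using mem by (simp add: small_UN small_Pow)
qed

lemma Vlevel_mono: "Ord \<alpha> \<Longrightarrow> \<beta> \<in> elts \<alpha> \<Longrightarrow> Vlevel \<beta> \<subseteq> Vlevel \<alpha>"
proof
  fix x assume \<beta>: "Ord \<alpha>" "\<beta> \<in> elts \<alpha>" and "x \<in> Vlevel \<beta>"
  then obtain \<gamma> where "\<gamma> \<in> elts \<beta>" "elts x \<subseteq> Vlevel \<gamma>" unfolding mem_Vlevel[of x \<beta>] by blast
  then show "x \<in> Vlevel \<alpha>" unfolding mem_Vlevel[of x \<alpha>] using Ord_trans[OF \<beta>] by blast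
qed

lemma Vlevel_trans: "Ord \<alpha> \<Longrightarrow> x \<in> Vlevel \<alpha> \<Longrightarrow> elts x \<subseteq> Vlevel \<alpha>"
  unfolding mem_Vlevel[of x] using Vlevel_mono by blast

lemma Ord_subset_Vlevel: "Ord \<alpha> \<Longrightarrow> elts \<alpha> \<subseteq> Vlevel \<alpha>"
proof (induction \<alpha> rule: mem_induct)
  case (mem \<alpha>)
  then show ?case by (meson Ord_mem mem_Vlevel subsetI)
qed

lemma vset_in_Vlevel:
  assumes "Z \<subseteq> Vlevel \<beta>" "\<beta> \<in> elts \<alpha>"
  shows "vset Z \<in> Vlevel \<alpha>"
  unfolding mem_Vlevel[of _ \<alpha>] elts_vset[OF small_subset[OF small_Vlevel assms(1)]]
  using assms by blast

lemma limit_Vlevel_mem: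
  assumes "limit_Ord \<alpha>" "x \<in> Vlevel \<alpha>"
  obtains \<beta> where "\<beta> \<in> elts \<alpha>" "x \<in> Vlevel \<beta>"
proof -
  obtain \<beta> where "\<beta> \<in> elts \<alpha>" "elts x \<subseteq> Vlevel \<beta>" using assms(2) mem_Vlevel by blast
  then have "osucc \<beta> \<in> elts \<alpha>" "x \<in> Vlevel (osucc \<beta>)"
    using assms(1) by (auto simp: limit_Ord_def mem_Vlevel)
  then show ?thesis using that by blast
qed

lemma limit_Ord_max:
  assumes "limit_Ord \<alpha>" "\<beta> \<in> elts \<alpha>" "\<gamma> \<in> elts \<alpha>"
  obtains \<mu> where "\<mu> \<in> elts \<alpha>" "Vlevel \<beta> \<subseteq> Vlevel \<mu>" "Vlevel \<gamma> \<subseteq> Vlevel \<mu>"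
proof -
  have "Ord \<beta>" "Ord \<gamma>" using assms Ord_mem by (auto simp: limit_Ord_def)
  then consider "Vlevel \<beta> \<subseteq> Vlevel \<gamma>" | "Vlevel \<gamma> \<subseteq> Vlevel \<beta>"
    using Ord_linear[of \<beta> \<gamma>] Vlevel_mono[of \<beta> \<gamma>] Vlevel_mono[of \<gamma> \<beta>] by auto
  then show ?thesis using that[of \<beta>] that[of \<gamma>] assms by cases auto
qed

section \<open>Cardinals\<close>

lemma Card_unique:
  assumes "Card x" "Card y" "elts x \<approx> elts y"
  shows "x = y"
proof -
  have "elts y \<approx> elts x" using assms(3) by (rule eqpoll_sym)
  then show ?thesis using assms Ord_linear[of x y] unfolding Card_def by blast
qed

text \<open>Makes an ordinal a HOL well-order, so that the comparison theorems for HOL cardinals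
  apply to it.\<close>

definition mem_order :: "'v::zfc \<Rightarrow> ('v \<times> 'v) set" where
  "mem_order x = {(a, b). a \<in> elts x \<and> b \<in> elts x \<and> (a = b \<or> a \<in> elts b)}"

lemma Field_mem_order: "Field (mem_order x) = elts x"
  by (auto simp: mem_order_def Field_def)

lemma underS_mem_order: "Ord x \<Longrightarrow> a \<in> elts x \<Longrightarrow> underS (mem_order x) a = elts a"
  by (auto simp: mem_order_def underS_def intro: Ord_trans)

lemma Well_order_mem_order:
  assumes "Ord x"
  shows "Well_order (mem_order x)"
proof -
  have "trans (mem_order x)"
  proof (rule transI)
    fix a b c assume "(a, b) \<in> mem_order x" "(b, c) \<in> mem_order x"
    then show "(a, c) \<in> mem_order x"
      using Ord_trans[OF Ord_mem[OF assms, of c]] by (auto simp: mem_order_def)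
  qed
  moreover have "refl_on (elts x) (mem_order x)" "mem_order x \<subseteq> elts x \<times> elts x"
    by (auto simp: mem_order_def refl_on_def)
  moreover have "antisym (mem_order x)"
    by (auto simp: antisym_def mem_order_def dest: mem_asym)
  moreover have "total_on (elts x) (mem_order x)"
    using Ord_linear Ord_mem[OF assms] by (auto simp: total_on_def mem_order_def)
  moreover have "wf (mem_order x - Id)"
    by (rule wf_subset[OF foundation]) (auto simp: mem_order_def)
  ultimately show ?thesis
    by (simp add: well_order_on_def linear_order_on_def partial_order_on_def preorder_on_def
        Field_mem_order)
qed

text \<open>Take the least ordinal \<kappa> into which \<open>X\<close> injects. If \<open>X\<close>
  were strictly smaller than \<kappa>, its cardinal order would be isomorphic to a proper initial
  segment of \<kappa>, that is, to an element of \<kappa>, against minimality. The bound by \<gamma>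
  later places the cardinal inside \<open>Vlevel \<alpha>\<close>.\<close>

lemma exists_Card:
  fixes X :: "'v::zfc set" and \<gamma> :: 'v
  assumes "Ord \<gamma>" "X \<subseteq> elts \<gamma>"
  obtains \<kappa> where "Card \<kappa>" "X \<approx> elts \<kappa>" "\<kappa> \<le>\<^sub>o \<gamma>"
proof -
  let ?Q = "{\<kappa>::'v. Ord \<kappa> \<and> X \<lesssim> elts \<kappa>}"
  have "\<gamma> \<in> ?Q" using assms by (simp add: subset_imp_lepoll)
  then have "\<exists>\<kappa>\<in>?Q. \<forall>\<beta>\<in>elts \<kappa>. \<beta> \<notin> ?Q" by (rule mem_minimal)
  then obtain \<kappa> where "\<kappa> \<in> ?Q" and min: "\<forall>\<beta>\<in>elts \<kappa>. \<beta> \<notin> ?Q"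
    by (rule bexE)
  from \<open>\<kappa> \<in> ?Q\<close> have \<kappa>: "Ord \<kappa>" "X \<lesssim> elts \<kappa>" by simp_all
  have min': "\<not> X \<lesssim> elts \<beta>" if "\<beta> \<in> elts \<kappa>" for \<beta>
    using bspec[OF min that] Ord_mem[OF \<kappa>(1) that] by simp
  let ?r = "mem_order \<kappa>"
  note wo = Well_order_mem_order[OF \<kappa>(1)]
  have "\<not> (card_of X, ?r) \<in> ordLess"
  proof
    assume "(card_of X, ?r) \<in> ordLess"
    then obtain a where a: "a \<in> elts \<kappa>" "(card_of X, Restr ?r (underS ?r a)) \<in> ordIso"
      using ordLess_iff_ordIso_Restr[OF wo card_of_Well_order] by (auto simp: Field_mem_order)
    have "(card_of X, card_of (Field (Restr ?r (underS ?r a)))) \<in> ordIso"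
      using card_of_cong[OF a(2)] by (simp add: Field_card_of)
    moreover have "Field (Restr ?r (underS ?r a)) \<subseteq> elts a"
      using Field_Restr_subset[of ?r] underS_mem_order[OF \<kappa>(1) a(1)] by blast
    ultimately have "X \<lesssim> elts a"
      using eqpoll_iff_card_of_ordIso lepoll_trans1 subset_imp_lepoll by blast
    then show False using min'[OF a(1)] by blast
  qed
  then have "(?r, card_of X) \<in> ordLeq"
    using not_ordLess_iff_ordLeq[OF wo card_of_Well_order] by blast
  then have "(card_of (elts \<kappa>), card_of X) \<in> ordLeq"
    using card_of_mono2[of ?r "card_of X"] by (simp add: Field_mem_order Field_card_of)
  then have "elts \<kappa> \<lesssim> X" using card_of_ordLeq by (metis lepoll_def)
  then have X: "X \<approx> elts \<kappa>" using \<kappa>(2) lepoll_antisym by blast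
  have "Card \<kappa>"
    unfolding Card_def using \<kappa> min' lepoll_trans2 eqpoll_sym by blast
  moreover have "\<gamma> \<notin> elts \<kappa>" using min' assms(2) subset_imp_lepoll by blast
  then have "\<kappa> \<le>\<^sub>o \<gamma>" using Ord_linear[OF \<kappa>(1) assms(1)] by blast
  ultimately show ?thesis using X that by blast
qed

section \<open>Absolute notions\<close>

text \<open>The closure under which the notions below become absolute. It is weak enough to be moved
  from \<open>Vlevel \<alpha>\<close> to \<open>M\<close>, yet gives the empty set, pairs, tuples of
  fixed length and the elements of flat pairs.\<close>

definition insert_closed :: "'v::zfc set \<Rightarrow> bool" where
  "insert_closed A \<longleftrightarrow> A \<noteq> {} \<and> (\<forall>x\<in>A. elts x \<subseteq> A) \<and> (\<forall>x\<in>A. \<forall>y\<in>A. vset (insert x (elts y)) \<in> A)"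

definition is_pair :: "'v::zfc set \<Rightarrow> 'v \<Rightarrow> 'v \<Rightarrow> 'v \<Rightarrow> bool" where
  "is_pair A z x y \<longleftrightarrow> (\<forall>u\<in>A. u \<in> elts z \<longleftrightarrow> u = x \<or> u = y)"

definition kpair :: "'v::zfc \<Rightarrow> 'v \<Rightarrow> 'v" where
  "kpair x y = vset {vset {x}, vset {x, y}}"

definition is_kpair :: "'v::zfc set \<Rightarrow> 'v \<Rightarrow> 'v \<Rightarrow> 'v \<Rightarrow> bool" where
  "is_kpair A z x y \<longleftrightarrow> (\<exists>p\<in>A. \<exists>q\<in>A. is_pair A p x x \<and> is_pair A q x y \<and> is_pair A z p q)"

definition is_empty :: "'v::zfc set \<Rightarrow> 'v \<Rightarrow> bool" where
  "is_empty A z \<longleftrightarrow> (\<forall>u\<in>A. u \<notin> elts z)"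

definition tag :: "'v::zfc" where
  "tag = vset {vset {vset {}}}"

definition is_tag :: "'v::zfc set \<Rightarrow> 'v \<Rightarrow> bool" where
  "is_tag A c \<longleftrightarrow> (\<exists>a\<in>A. \<exists>b\<in>A. is_empty A a \<and> is_pair A b a a \<and> is_pair A c b b)"

definition is_fpair :: "'v::zfc set \<Rightarrow> 'v \<Rightarrow> 'v \<Rightarrow> 'v \<Rightarrow> bool" where
  "is_fpair A z x y \<longleftrightarrow> (\<exists>c\<in>A. is_tag A c \<and> (\<forall>u\<in>A. u \<in> elts z \<longleftrightarrow>
     u \<in> elts x \<or> (\<exists>b\<in>A. b \<in> elts y \<and> (\<forall>w\<in>A. w \<in> elts u \<longleftrightarrow> w = c \<or> w \<in> elts b))))"

definition is_Ord :: "'v::zfc set \<Rightarrow> 'v \<Rightarrow> bool" where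
  "is_Ord A x \<longleftrightarrow> (\<forall>y\<in>A. y \<in> elts x \<longrightarrow> (\<forall>z\<in>A. z \<in> elts y \<longrightarrow> z \<in> elts x \<and>
     (\<forall>w\<in>A. w \<in> elts z \<longrightarrow> w \<in> elts y)))"

definition codes :: "'v::zfc set \<Rightarrow> 'v \<Rightarrow> 'v \<Rightarrow> 'v \<Rightarrow> bool" where
  "codes A f x y \<longleftrightarrow> (\<exists>z\<in>A. z \<in> elts f \<and> is_fpair A z x y)"

text \<open>Phrased through the relation \<open>codes\<close> instead of the exact elements of
  \<open>f\<close>, so \<open>f\<close> may contain anything else. A witness yields a true bijection
  for arbitrary \<open>X\<close> and \<open>Y\<close> in the class, although flat pairs decode
  uniquely only for ordinals.\<close>

definition is_bij :: "'v::zfc set \<Rightarrow> 'v \<Rightarrow> 'v \<Rightarrow> 'v \<Rightarrow> bool" where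
  "is_bij A f X Y \<longleftrightarrow>
     (\<forall>x\<in>A. x \<in> elts X \<longrightarrow> (\<exists>y\<in>A. y \<in> elts Y \<and> codes A f x y)) \<and>
     (\<forall>y\<in>A. y \<in> elts Y \<longrightarrow> (\<exists>x\<in>A. x \<in> elts X \<and> codes A f x y)) \<and>
     (\<forall>x\<in>A. \<forall>x'\<in>A. \<forall>y\<in>A. \<forall>y'\<in>A. x \<in> elts X \<and> x' \<in> elts X \<and> y \<in> elts Y \<and> y' \<in> elts Y \<and>
        codes A f x y \<and> codes A f x' y' \<longrightarrow> (x = x' \<longleftrightarrow> y = y'))"

definition is_Card :: "'v::zfc set \<Rightarrow> 'v \<Rightarrow> bool" where
  "is_Card A x \<longleftrightarrow> is_Ord A x \<and> (\<forall>y\<in>A. y \<in> elts x \<longrightarrow> \<not> (\<exists>f\<in>A. is_bij A f y x))"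

primrec tup :: "'v::zfc list \<Rightarrow> 'v" where
  "tup [] = vset {}"
| "tup (x # xs) = kpair x (tup xs)"

text \<open>\<open>n\<close> is a HOL number, not an element of the model: each \<open>n\<close>
  gives its own formula. This fits the arities, which are HOL numbers too.\<close>

primrec is_tup :: "nat \<Rightarrow> 'v::zfc set \<Rightarrow> 'v \<Rightarrow> 'v \<Rightarrow> bool" where
  "is_tup 0 A D w \<longleftrightarrow> is_empty A w"
| "is_tup (Suc n) A D w \<longleftrightarrow>
     (\<exists>x\<in>A. x \<in> elts D \<and> (\<exists>v\<in>A. is_tup n A D v \<and> is_kpair A w x v))"

lemma fmla_is_pair: "fmla (\<lambda>A e. is_pair A (e z) (e x) (e y))"
  unfolding is_pair_def by (intro fmla_intros)

lemma fmla_is_kpair: "fmla (\<lambda>A e. is_kpair A (e z) (e x) (e y))"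
  unfolding is_kpair_def by (intro fmla_intros fmla_is_pair)

lemma fmla_is_empty: "fmla (\<lambda>A e. is_empty A (e z))"
  unfolding is_empty_def by (intro fmla_intros)

lemma fmla_is_tag: "fmla (\<lambda>A e. is_tag A (e z))"
  unfolding is_tag_def by (intro fmla_intros fmla_is_pair fmla_is_empty)

lemma fmla_is_fpair: "fmla (\<lambda>A e. is_fpair A (e z) (e x) (e y))"
  unfolding is_fpair_def by (intro fmla_intros fmla_is_tag)

lemma fmla_is_Ord: "fmla (\<lambda>A e. is_Ord A (e x))"
  unfolding is_Ord_def by (intro fmla_intros)

lemma fmla_codes: "fmla (\<lambda>A e. codes A (e f) (e x) (e y))"
  unfolding codes_def by (intro fmla_intros fmla_is_fpair)

lemma fmla_is_bij: "fmla (\<lambda>A e. is_bij A (e f) (e x) (e y))"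
  unfolding is_bij_def by (intro fmla_intros fmla_codes)

lemma fmla_is_Card: "fmla (\<lambda>A e. is_Card A (e x))"
  unfolding is_Card_def by (intro fmla_intros fmla_is_bij fmla_is_Ord)

lemma fmla_is_tup: "fmla (\<lambda>A e. is_tup n A (e d) (e w))"
proof -
  \<comment> \<open>The index type is fixed during the induction, whereas each quantifier wraps it
    in \<open>option\<close>. Two slots, indexed by \<open>bool\<close>, are enough, and reindexing
    takes the induction hypothesis to the larger type.\<close>
  have "fmla (\<lambda>A (e :: bool \<Rightarrow> 'a). is_tup n A (e False) (e True))"
  proof (induction n)
    case 0
    then show ?case by (simp add: fmla_is_empty)
  next
    case (Suc n)
    have IH: "fmla (\<lambda>A (e :: bool option option \<Rightarrow> 'a). is_tup n A (e d) (e w))" for d w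
      using fmla_reindex[OF Suc.IH, of "case_bool w d"] by simp
    show ?case unfolding is_tup.simps by (intro fmla_intros fmla_is_kpair IH)
  qed
  from fmla_reindex[OF this, of "case_bool w d"] show ?thesis by simp
qed

lemmas fmla_notions = fmla_is_pair fmla_is_kpair fmla_is_empty fmla_is_tag fmla_is_fpair
  fmla_is_Ord fmla_codes fmla_is_bij fmla_is_Card fmla_is_tup

lemma kpair_inject [simp]: "kpair x y = kpair x' y' \<longleftrightarrow> x = x' \<and> y = y'"
  by (auto simp: kpair_def vset_inject doubleton_eq_iff)

lemma kpair_nonempty: "kpair x y \<noteq> vset {}"
  by (simp add: kpair_def vset_inject)

lemma tup_inject [simp]: "tup xs = tup ys \<longleftrightarrow> xs = ys"
proof (induction xs arbitrary: ys)
  case Nil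
  then show ?case by (cases ys) (auto simp: kpair_nonempty[symmetric])
next
  case (Cons x xs)
  then show ?case by (cases ys) (auto simp: kpair_nonempty)
qed

lemma eq_vset_iff: "small B \<Longrightarrow> z = vset B \<longleftrightarrow> elts z = B"
  by (metis elts_vset vset_elts)

section \<open>Absoluteness in transitive classes closed under insertion\<close>

context
  fixes A :: "'v::zfc set"
  assumes A: "insert_closed A"
begin

lemma insert_closed_elts: "x \<in> A \<Longrightarrow> y \<in> elts x \<Longrightarrow> y \<in> A"
  using A by (auto simp: insert_closed_def)

lemma insert_closed_insert: "x \<in> A \<Longrightarrow> y \<in> A \<Longrightarrow> vset (insert x (elts y)) \<in> A"
  using A by (auto simp: insert_closed_def)

text \<open>A membership-minimal element of \<open>A\<close> has no elements in \<open>A\<close>,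
  hence none at all because \<open>A\<close> is transitive.\<close>

lemma insert_closed_empty: "vset {} \<in> A"
proof -
  obtain x where "x \<in> A" using A by (auto simp: insert_closed_def)
  then obtain z where "z \<in> A" "\<forall>y\<in>elts z. y \<notin> A"
    using mem_minimal[of x A] by blast
  then have "elts z = {}" using insert_closed_elts by blast
  then show ?thesis using \<open>z \<in> A\<close> by (metis vset_elts)
qed

lemma insert_closed_singleton: "x \<in> A \<Longrightarrow> vset {x} \<in> A"
  using insert_closed_insert[OF _ insert_closed_empty, of x] by simp

lemma insert_closed_pair: "x \<in> A \<Longrightarrow> y \<in> A \<Longrightarrow> vset {x, y} \<in> A"
  using insert_closed_insert[OF _ insert_closed_singleton, of x y] by simp

text \<open>The source of all the absoluteness results: a transitive \<open>A\<close> sees every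
  element of its members, so quantifiers restricted to \<open>A\<close> decide equality of
  sets.\<close>

lemma elts_eqI: "z \<in> A \<Longrightarrow> B \<subseteq> A \<Longrightarrow> (\<forall>u\<in>A. u \<in> elts z \<longleftrightarrow> u \<in> B) \<longleftrightarrow> elts z = B"
  using insert_closed_elts by blast

lemma is_pair_iff: "z \<in> A \<Longrightarrow> x \<in> A \<Longrightarrow> y \<in> A \<Longrightarrow> is_pair A z x y \<longleftrightarrow> z = vset {x, y}"
  unfolding is_pair_def using elts_eqI[of z "{x, y}"] by (simp add: eq_vset_iff)

lemma is_kpair_iff: "z \<in> A \<Longrightarrow> x \<in> A \<Longrightarrow> y \<in> A \<Longrightarrow> is_kpair A z x y \<longleftrightarrow> z = kpair x y"
  unfolding is_kpair_def kpair_def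
  using insert_closed_pair[of x y] insert_closed_singleton[of x] by (auto simp: is_pair_iff)

lemma kpair_closed: "x \<in> A \<Longrightarrow> y \<in> A \<Longrightarrow> kpair x y \<in> A"
  by (simp add: kpair_def insert_closed_pair insert_closed_singleton)

lemma is_empty_iff: "z \<in> A \<Longrightarrow> is_empty A z \<longleftrightarrow> z = vset {}"
  unfolding is_empty_def using elts_eqI[of z "{}"] by (simp add: eq_vset_iff)

lemma tag_closed: "tag \<in> A"
  by (simp add: tag_def insert_closed_singleton insert_closed_empty)

lemma is_tag_iff: "z \<in> A \<Longrightarrow> is_tag A z \<longleftrightarrow> z = tag"
  unfolding is_tag_def tag_def
  using insert_closed_singleton[of "vset {}"] insert_closed_empty
  by (auto simp: is_pair_iff is_empty_iff)

lemma is_Ord_iff: "x \<in> A \<Longrightarrow> is_Ord A x \<longleftrightarrow> Ord x"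
  unfolding is_Ord_def Ord_def transitive_set_def using insert_closed_elts by blast

lemma tup_closed: "set xs \<subseteq> A \<Longrightarrow> tup xs \<in> A"
  by (induction xs) (auto simp: kpair_closed insert_closed_empty)

lemma is_tup_iff:
  "D \<in> A \<Longrightarrow> w \<in> A \<Longrightarrow>
     is_tup n A D w \<longleftrightarrow> (\<exists>as. length as = n \<and> set as \<subseteq> elts D \<and> w = tup as)"
proof (induction n arbitrary: w)
  case 0
  then show ?case by (simp add: is_empty_iff)
next
  case (Suc n)
  show ?case
  proof
    assume "is_tup (Suc n) A D w"
    then obtain x v as where "x \<in> elts D" "x \<in> A" "v \<in> A" "is_kpair A w x v" "length as = n"
      "set as \<subseteq> elts D" "v = tup as"
      using Suc by auto
    then show "\<exists>as. length as = Suc n \<and> set as \<subseteq> elts D \<and> w = tup as"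
      using Suc.prems by (intro exI[of _ "x # as"]) (simp add: is_kpair_iff)
  next
    assume "\<exists>as. length as = Suc n \<and> set as \<subseteq> elts D \<and> w = tup as"
    then obtain x as where as: "length as = n" "set as \<subseteq> elts D" "x \<in> elts D" "w = kpair x (tup as)"
      by (auto simp: length_Suc_conv)
    then have "set as \<subseteq> A" "x \<in> A" using insert_closed_elts[OF Suc.prems(1)] by auto
    then have "tup as \<in> A" "x \<in> A" "is_tup n A D (tup as)" "is_kpair A w x (tup as)"
      using Suc as tup_closed by (auto simp: is_kpair_iff)
    then show "is_tup (Suc n) A D w" using as by auto
  qed
qed

end

section \<open>Flat pairs and coded bijections\<close>

lemma elts_flat_pair:
  "elts (flat_pair x y) = elts x \<union> (\<lambda>b. vset (insert tag (elts b))) ` elts y"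
  by (simp add: flat_pair_def tag_def)

lemma is_fpair_iff:
  assumes A: "insert_closed A" and "z \<in> A" "x \<in> A" "y \<in> A"
  shows "is_fpair A z x y \<longleftrightarrow> z = flat_pair x y"
proof -
  note trans = insert_closed_elts[OF A]
  have sub: "elts (flat_pair x y) \<subseteq> A"
    using trans[OF \<open>x \<in> A\<close>] trans[OF \<open>y \<in> A\<close>] insert_closed_insert[OF A tag_closed[OF A]]
    by (auto simp: elts_flat_pair)
  have "(\<forall>w\<in>A. w \<in> elts u \<longleftrightarrow> w = tag \<or> w \<in> elts b) \<longleftrightarrow> u = vset (insert tag (elts b))"
    if "u \<in> A" "b \<in> A" for u b
    using elts_eqI[OF A that(1), of "insert tag (elts b)"] trans[OF that(2)] tag_closed[OF A]
    by (simp add: eq_vset_iff subset_iff)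
  then have "is_fpair A z x y \<longleftrightarrow> (\<forall>u\<in>A. u \<in> elts z \<longleftrightarrow>
      u \<in> elts x \<or> (\<exists>b\<in>A. b \<in> elts y \<and> u = vset (insert tag (elts b))))"
    using tag_closed[OF A] is_tag_iff[OF A] unfolding is_fpair_def by simp
  also have "\<dots> \<longleftrightarrow> (\<forall>u\<in>A. u \<in> elts z \<longleftrightarrow> u \<in> elts (flat_pair x y))"
    unfolding elts_flat_pair using trans[OF \<open>y \<in> A\<close>] by (auto simp: image_iff)
  also have "\<dots> \<longleftrightarrow> z = flat_pair x y"
    using elts_eqI[OF A \<open>z \<in> A\<close> sub] by simp
  finally show ?thesis .
qed

lemma tag_notin_Ord:
  assumes "Ord x"
  shows "tag \<notin> elts x"
proof
  assume "tag \<in> elts x"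
  then have "transitive_set (tag :: 'a)" using Ord_mem[OF assms] by (auto simp: Ord_def)
  then have "vset {} = vset {vset {} :: 'a}" by (auto simp: transitive_set_def tag_def)
  then show False by (simp add: vset_inject)
qed

text \<open>Elements of the pair are sorted by whether they contain \<open>tag\<close>. Those from
  \<open>x\<close> are ordinals and do not; those from \<open>y\<close> do, and removing
  \<open>tag\<close> recovers the original ordinal because \<open>tag\<close> was not in it.\<close>

lemma flat_pair_inject:
  assumes "Ord x" "Ord y" "Ord x'" "Ord y'"
  shows "flat_pair x y = flat_pair x' y' \<longleftrightarrow> x = x' \<and> y = y'"
proof
  assume eq: "flat_pair x y = flat_pair x' y'"
  let ?t = "\<lambda>b :: 'a. vset (insert tag (elts b))"
  have fst: "elts x = {u \<in> elts (flat_pair x y). tag \<notin> elts u}" if "Ord x" for x y :: 'a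
    using tag_notin_Ord[OF Ord_mem[OF that]] by (auto simp: elts_flat_pair)
  have snd: "?t ` elts y = {u \<in> elts (flat_pair x y). tag \<in> elts u}" if "Ord x" for x y :: 'a
    using tag_notin_Ord[OF Ord_mem[OF that]] by (auto simp: elts_flat_pair)
  have "elts x = elts x'" using fst[of x y] fst[of x' y'] assms eq by simp
  moreover have "elts y = elts y'"
  proof -
    have "inj_on ?t {b. Ord b}"
    proof (rule inj_onI)
      fix b c :: 'a assume "b \<in> {b. Ord b}" "c \<in> {b. Ord b}" "?t b = ?t c"
      then have "insert tag (elts b) = insert tag (elts c)" "tag \<notin> elts b" "tag \<notin> elts c"
        using tag_notin_Ord by (auto simp: vset_inject)
      then show "b = c" by (simp add: insert_ident)
    qed
    moreover have "elts y \<subseteq> {b. Ord b}" "elts y' \<subseteq> {b. Ord b}" using assms Ord_mem by auto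
    moreover have "?t ` elts y = ?t ` elts y'" using snd[of x y] snd[of x' y'] assms eq by simp
    ultimately show ?thesis using inj_on_image_eq_iff by blast
  qed
  ultimately show "x = x' \<and> y = y'" by simp
qed simp

lemma codes_iff:
  assumes A: "insert_closed A" and "f \<in> A" "x \<in> A" "y \<in> A"
  shows "codes A f x y \<longleftrightarrow> flat_pair x y \<in> elts f"
  using insert_closed_elts[OF A \<open>f \<in> A\<close>] is_fpair_iff[OF A] assms unfolding codes_def by auto

lemma is_bij_code:
  assumes A: "insert_closed A" and "f \<in> A" "X \<in> A" "Y \<in> A"
    and Ord: "\<And>x. x \<in> elts X \<Longrightarrow> Ord x" "\<And>y. y \<in> elts Y \<Longrightarrow> Ord y"
    and g: "bij_betw g (elts X) (elts Y)" and f: "elts f = (\<lambda>x. flat_pair x (g x)) ` elts X"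
  shows "is_bij A f X Y"
proof -
  have gY: "g x \<in> elts Y" if "x \<in> elts X" for x using g that by (rule bij_betwE[rule_format])
  have XA: "x \<in> A" if "x \<in> elts X" for x using insert_closed_elts[OF A \<open>X \<in> A\<close> that] .
  have YA: "y \<in> A" if "y \<in> elts Y" for y using insert_closed_elts[OF A \<open>Y \<in> A\<close> that] .
  have codes: "codes A f x y \<longleftrightarrow> y = g x" if "x \<in> elts X" "y \<in> elts Y" for x y
  proof -
    have "codes A f x y \<longleftrightarrow> (\<exists>x'\<in>elts X. flat_pair x y = flat_pair x' (g x'))"
      using codes_iff[OF A \<open>f \<in> A\<close>] XA YA that by (auto simp: f)
    also have "\<dots> \<longleftrightarrow> (\<exists>x'\<in>elts X. x = x' \<and> y = g x')"
      using Ord gY that by (intro bex_cong refl) (simp add: flat_pair_inject)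
    finally show ?thesis using that by auto
  qed
  have inj: "g x = g x' \<longleftrightarrow> x = x'" if "x \<in> elts X" "x' \<in> elts X" for x x'
    using g that by (auto simp: bij_betw_def inj_on_def)
  have surj: "\<exists>x\<in>elts X. y = g x" if "y \<in> elts Y" for y
    using g that by (auto simp: bij_betw_def)
  show ?thesis
    unfolding is_bij_def
  proof (intro conjI ballI impI)
    fix x assume "x \<in> A" "x \<in> elts X"
    then show "\<exists>y\<in>A. y \<in> elts Y \<and> codes A f x y" using gY YA codes by blast
  next
    fix y assume "y \<in> A" "y \<in> elts Y"
    then show "\<exists>x\<in>A. x \<in> elts X \<and> codes A f x y" using surj XA codes by blast
  next
    fix x x' y y'
    assume "x \<in> elts X \<and> x' \<in> elts X \<and> y \<in> elts Y \<and> y' \<in> elts Y \<and> codes A f x y \<and> codes A f x' y'"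
    then show "x = x' \<longleftrightarrow> y = y'" using inj codes by metis
  qed
qed

lemma is_bij_eqpoll:
  assumes A: "insert_closed A" and "X \<in> A" "Y \<in> A" and bij: "is_bij A f X Y"
  shows "elts X \<approx> elts Y"
proof -
  have XA: "x \<in> A" if "x \<in> elts X" for x using insert_closed_elts[OF A \<open>X \<in> A\<close> that] .
  have YA: "y \<in> A" if "y \<in> elts Y" for y using insert_closed_elts[OF A \<open>Y \<in> A\<close> that] .
  have uniq: "x = x' \<longleftrightarrow> y = y'"
    if "x \<in> elts X" "x' \<in> elts X" "y \<in> elts Y" "y' \<in> elts Y" "codes A f x y" "codes A f x' y'"
    for x x' y y'
    using bij that XA YA unfolding is_bij_def by blast
  have "\<forall>x\<in>elts X. \<exists>y. y \<in> elts Y \<and> codes A f x y"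
    using bij XA unfolding is_bij_def by blast
  then obtain g where g: "\<And>x. x \<in> elts X \<Longrightarrow> g x \<in> elts Y" "\<And>x. x \<in> elts X \<Longrightarrow> codes A f x (g x)"
    by metis
  have "bij_betw g (elts X) (elts Y)"
  proof (rule bij_betwI')
    show "g x = g x' \<longleftrightarrow> x = x'" if "x \<in> elts X" "x' \<in> elts X" for x x'
      using uniq that g by blast
    show "g x \<in> elts Y" if "x \<in> elts X" for x using g that by blast
    show "\<exists>x\<in>elts X. y = g x" if y: "y \<in> elts Y" for y
    proof -
      obtain x where x: "x \<in> elts X" "codes A f x y"
        using bij YA[OF y] y unfolding is_bij_def by blast
      then show ?thesis using uniq[OF x(1) x(1) y g(1)[OF x(1)] x(2) g(2)[OF x(1)]] by blast
    qed
  qed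
  then show ?thesis by (auto simp: eqpoll_def)
qed

lemma Card_imp_is_Card:
  assumes A: "insert_closed A" and "x \<in> A" "Card x"
  shows "is_Card A x"
proof -
  have "\<not> is_bij A f y x" if "y \<in> elts x" "y \<in> A" for f y
    using is_bij_eqpoll[OF A that(2) assms(2)] assms(3) that(1) by (auto simp: Card_def)
  then show ?thesis
    using assms by (auto simp: is_Card_def is_Ord_iff[OF A] Card_def)
qed

text \<open>The formula \<open>is_Card\<close> rules out every \<open>is_bij\<close> code, and by
  \<open>is_bij_code\<close> these include the exact graphs of \<open>is_bijection\<close> that
  \<open>believes_cardinal\<close> rules out.\<close>

lemma is_Card_believes_cardinal:
  assumes M: "insert_closed (elts M)" and "x \<in> elts M" "is_Card (elts M) x"
  shows "believes_cardinal M x"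
proof -
  have x: "Ord x" using assms by (simp add: is_Card_def is_Ord_iff[OF M])
  have "\<not> is_bijection f y x" if "y \<in> elts x" "f \<in> elts M" for f y
  proof
    assume "is_bijection f y x"
    then obtain g where g: "bij_betw g (elts y) (elts x)" "elts f = (\<lambda>\<xi>. flat_pair \<xi> (g \<xi>)) ` elts y"
      by (auto simp: is_bijection_def)
    have y: "y \<in> elts M" using insert_closed_elts[OF M assms(2) that(1)] .
    have "is_bij (elts M) f y x"
      using x Ord_mem Ord_mem[OF Ord_mem[OF x that(1)]]
      by (intro is_bij_code[OF M that(2) y assms(2) _ _ g]) auto
    then show False using assms(3) that y by (auto simp: is_Card_def)
  qed
  then show ?thesis using assms(2) x by (auto simp: believes_cardinal_def)
qed

section \<open>Classes that recognise cardinals correctly\<close>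

definition correct_class :: "'v::zfc set \<Rightarrow> bool" where
  "correct_class A \<longleftrightarrow> insert_closed A \<and> (\<forall>x\<in>A. is_Card A x \<longrightarrow> Card x)"

lemma correct_class_elts:
  "insert_closed (elts M) \<Longrightarrow> cardinal_correct M \<Longrightarrow> correct_class (elts M)"
  using is_Card_believes_cardinal by (auto simp: correct_class_def cardinal_correct_def)

lemma insert_closed_Vlevel:
  assumes \<alpha>: "limit_Ord \<alpha>"
  shows "insert_closed (Vlevel \<alpha>)"
proof -
  have Ord: "Ord \<alpha>" using \<alpha> by (simp add: limit_Ord_def)
  have "Vlevel \<alpha> \<noteq> {}" using \<alpha> Ord_subset_Vlevel[OF Ord] by (auto simp: limit_Ord_def)
  moreover have "vset (insert x (elts y)) \<in> Vlevel \<alpha>" if x: "x \<in> Vlevel \<alpha>" and y: "y \<in> Vlevel \<alpha>" for x y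
  proof -
    obtain \<beta> where \<beta>: "\<beta> \<in> elts \<alpha>" "x \<in> Vlevel \<beta>" using limit_Vlevel_mem[OF \<alpha> x] .
    obtain \<gamma> where \<gamma>: "\<gamma> \<in> elts \<alpha>" "elts y \<subseteq> Vlevel \<gamma>" using y mem_Vlevel[of y] by blast
    obtain \<mu> where \<mu>: "\<mu> \<in> elts \<alpha>" "Vlevel \<beta> \<subseteq> Vlevel \<mu>" "Vlevel \<gamma> \<subseteq> Vlevel \<mu>"
      using limit_Ord_max[OF \<alpha> \<beta>(1) \<gamma>(1)] .
    show ?thesis by (rule vset_in_Vlevel[OF _ \<mu>(1)]) (use \<beta> \<gamma> \<mu> in blast)
  qed
  ultimately show ?thesis using Vlevel_trans[OF Ord] by (auto simp: insert_closed_def)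
qed

lemma Vlevel_osucc: "elts x \<subseteq> Vlevel \<beta> \<Longrightarrow> x \<in> Vlevel (osucc \<beta>)"
  by (subst mem_Vlevel) auto

lemma Vlevel_subset_osucc: "Ord \<beta> \<Longrightarrow> Vlevel \<beta> \<subseteq> Vlevel (osucc \<beta>)"
  by (rule Vlevel_mono) (auto simp: Ord_osucc)

text \<open>Let \<mu> bound both \<gamma> and the rank of \<open>tag\<close>. One level above \<mu>
  come the tagged elements, one more the flat pairs; the code, as a set of these, lies in
  \<open>Vlevel \<alpha>\<close> since \<alpha> is a limit.\<close>

lemma code_in_Vlevel:
  assumes \<alpha>: "limit_Ord \<alpha>" and \<gamma>: "\<gamma> \<in> elts \<alpha>" and "X \<subseteq> elts \<gamma>" "g ` X \<subseteq> elts \<gamma>"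
  shows "vset ((\<lambda>x. flat_pair x (g x)) ` X) \<in> Vlevel \<alpha>"
proof -
  have Ord: "Ord \<alpha>" using \<alpha> by (simp add: limit_Ord_def)
  have "tag \<in> Vlevel \<alpha>" using tag_closed[OF insert_closed_Vlevel[OF \<alpha>]] .
  then obtain \<beta> where \<beta>: "\<beta> \<in> elts \<alpha>" "tag \<in> Vlevel \<beta>" using limit_Vlevel_mem[OF \<alpha>] by blast
  obtain \<mu> where \<mu>: "\<mu> \<in> elts \<alpha>" "Vlevel \<beta> \<subseteq> Vlevel \<mu>" "Vlevel \<gamma> \<subseteq> Vlevel \<mu>"
    using limit_Ord_max[OF \<alpha> \<beta>(1) \<gamma>] .
  have Ord\<mu>: "Ord \<mu>" and Ord\<gamma>: "Ord \<gamma>" using Ord_mem[OF Ord] \<mu> \<gamma> by auto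
  have sub: "elts x \<subseteq> Vlevel \<mu>" if "x \<in> elts \<gamma>" for x
    using that Ord_trans[OF Ord\<gamma>] Ord_subset_Vlevel[OF Ord\<gamma>] \<mu>(3) by blast
  have "vset (insert tag (elts b)) \<in> Vlevel (osucc \<mu>)" if "b \<in> elts y" "y \<in> elts \<gamma>" for b y
    using Ord_trans[OF Ord\<gamma> that(2) that(1)] sub \<beta> \<mu> by (intro Vlevel_osucc) auto
  then have "elts (flat_pair x y) \<subseteq> Vlevel (osucc \<mu>)" if "x \<in> elts \<gamma>" "y \<in> elts \<gamma>" for x y
    using sub[OF that(1)] Vlevel_subset_osucc[OF Ord\<mu>] that by (auto simp: elts_flat_pair)
  then have "flat_pair x (g x) \<in> Vlevel (osucc (osucc \<mu>))" if "x \<in> X" for x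
    using that assms(3,4) by (intro Vlevel_osucc) blast
  then have "(\<lambda>x. flat_pair x (g x)) ` X \<subseteq> Vlevel (osucc (osucc \<mu>))" by blast
  moreover have "osucc (osucc \<mu>) \<in> elts \<alpha>" using \<alpha> \<mu>(1) by (auto simp: limit_Ord_def)
  ultimately show ?thesis by (rule vset_in_Vlevel)
qed

lemma is_bij_Vlevel:
  assumes \<alpha>: "limit_Ord \<alpha>" and \<gamma>: "\<gamma> \<in> elts \<alpha>" and X: "elts X \<subseteq> elts \<gamma>" and Y: "elts Y \<subseteq> elts \<gamma>"
    and "elts X \<approx> elts Y"
  shows "\<exists>f\<in>Vlevel \<alpha>. is_bij (Vlevel \<alpha>) f X Y"
proof -
  have Ord: "Ord \<alpha>" using \<alpha> by (simp add: limit_Ord_def)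
  obtain g where g: "bij_betw g (elts X) (elts Y)" using assms(5) by (auto simp: eqpoll_def)
  define f where "f = vset ((\<lambda>x. flat_pair x (g x)) ` elts X)"
  have f: "f \<in> Vlevel \<alpha>"
    unfolding f_def using X Y g by (intro code_in_Vlevel[OF \<alpha> \<gamma>]) (auto simp: bij_betw_def)
  have "Z \<in> Vlevel \<alpha>" if "elts Z \<subseteq> elts \<gamma>" for Z
    using that \<gamma> Ord_subset_Vlevel[OF Ord_mem[OF Ord \<gamma>]] mem_Vlevel[of Z \<alpha>] by blast
  then have "is_bij (Vlevel \<alpha>) f X Y"
    using X Y Ord_mem[OF Ord_mem[OF Ord \<gamma>]]
    by (intro is_bij_code[OF insert_closed_Vlevel[OF \<alpha>] f _ _ _ _ g]) (auto simp: f_def)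
  then show ?thesis using f by blast
qed

text \<open>An ordinal in \<open>Vlevel \<alpha>\<close> is below \<alpha>, so every bijection in
  the universe from a smaller ordinal onto it has a code in \<open>Vlevel \<alpha>\<close>.\<close>

lemma correct_class_Vlevel:
  assumes \<alpha>: "limit_Ord \<alpha>"
  shows "correct_class (Vlevel \<alpha>)"
proof -
  note closed = insert_closed_Vlevel[OF \<alpha>]
  have Ord: "Ord \<alpha>" using \<alpha> by (simp add: limit_Ord_def)
  have "Card x" if x: "x \<in> Vlevel \<alpha>" "is_Card (Vlevel \<alpha>) x" for x
  proof -
    have "Ord x" using x by (simp add: is_Card_def is_Ord_iff[OF closed])
    have "x \<in> elts \<alpha>"
    proof (rule ccontr)
      assume "x \<notin> elts \<alpha>"
      \<comment> \<open>A level that contains all elements of \<open>x\<close> then contains all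
        elements of \<alpha>, which would put \<alpha> into \<open>Vlevel \<alpha>\<close>.\<close>
      then have "elts \<alpha> \<subseteq> elts x"
        using Ord_linear[OF \<open>Ord x\<close> Ord] Ord_trans[OF \<open>Ord x\<close>] by blast
      then have "\<alpha> \<in> Vlevel \<alpha>" using x(1) unfolding mem_Vlevel[of _ \<alpha>] by blast
      moreover have "\<beta> \<notin> Vlevel \<beta>" if "Ord \<beta>" for \<beta> :: 'a
        using that
      proof (induction \<beta> rule: mem_induct)
        case (mem \<beta>)
        then show ?case using mem_Vlevel[of \<beta> \<beta>] Ord_mem by blast
      qed
      ultimately show False using Ord by blast
    qed
    then have "osucc x \<in> elts \<alpha>" using \<alpha> by (auto simp: limit_Ord_def)
    have "\<not> elts \<beta> \<approx> elts x" if "\<beta> \<in> elts x" for \<beta>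
    proof
      assume "elts \<beta> \<approx> elts x"
      moreover have "elts \<beta> \<subseteq> elts x" using that Ord_trans[OF \<open>Ord x\<close>] by blast
      ultimately have "\<exists>f\<in>Vlevel \<alpha>. is_bij (Vlevel \<alpha>) f \<beta> x"
        by (intro is_bij_Vlevel[OF \<alpha> \<open>x \<in> elts \<alpha>\<close>]) auto
      then show False using x that insert_closed_elts[OF closed x(1) that] by (auto simp: is_Card_def)
    qed
    then show ?thesis using \<open>Ord x\<close> by (auto simp: Card_def)
  qed
  then show ?thesis using closed by (auto simp: correct_class_def)
qed

text \<open>Here \<open>X\<close> is an arbitrary subset of \<gamma>, definable or not:
  \<open>Vlevel \<alpha>\<close> is full. \<open>M\<close> receives the corresponding statement for
  definable sets by transfer.\<close>

lemma Vlevel_subsets_have_Card: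
  assumes \<alpha>: "limit_Ord \<alpha>" and \<gamma>: "\<gamma> \<in> elts \<alpha>" and X: "X \<subseteq> elts \<gamma>"
  shows "\<exists>D\<in>Vlevel \<alpha>. elts D = X \<and> (\<exists>k\<in>Vlevel \<alpha>. \<exists>f\<in>Vlevel \<alpha>. is_Card (Vlevel \<alpha>) k \<and> is_bij (Vlevel \<alpha>) f D k)"
proof -
  have Ord: "Ord \<alpha>" using \<alpha> by (simp add: limit_Ord_def)
  note Ord\<gamma> = Ord_mem[OF Ord \<gamma>]
  have D: "vset X \<in> Vlevel \<alpha>" "elts (vset X) = X"
    using X Ord_subset_Vlevel[OF Ord\<gamma>] \<gamma> small_subset[OF small_elts X]
    by (auto intro: vset_in_Vlevel)
  obtain k where k: "Card k" "X \<approx> elts k" "k \<le>\<^sub>o \<gamma>" using exists_Card[OF Ord\<gamma> X] .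
  have "k \<in> elts \<alpha>" using k(3) Ord_trans[OF Ord \<gamma>] \<gamma> by blast
  then have "k \<in> Vlevel \<alpha>" using Ord_subset_Vlevel[OF Ord] by blast
  moreover have "is_Card (Vlevel \<alpha>) k"
    using Card_imp_is_Card[OF insert_closed_Vlevel[OF \<alpha>] _ k(1)] \<open>k \<in> Vlevel \<alpha>\<close> by blast
  moreover have "elts k \<subseteq> elts \<gamma>" using k(3) Ord_trans[OF Ord\<gamma>] by blast
  then have "\<exists>f\<in>Vlevel \<alpha>. is_bij (Vlevel \<alpha>) f (vset X) k"
    using X D k(2) by (intro is_bij_Vlevel[OF \<alpha> \<gamma>]) auto
  ultimately show ?thesis using D by blast
qed

section \<open>Translating the logic with the Haertig quantifier\<close>

text \<open>Symbols serve as names of parameters. One formula mentions finitely many of them and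
  \<open>j\<close> moves each graph separately, so neither the symbols nor the family of all graphs
  has to be an element of \<open>Vlevel \<alpha>\<close>.\<close>

datatype 'v idx = Vr nat | Dom | RS 'v | FS 'v

definition env :: "('v idx \<Rightarrow> 'v) \<Rightarrow> (nat \<Rightarrow> 'v) \<Rightarrow> 'v idx \<Rightarrow> 'v" where
  "env G s i = (case i of Vr n \<Rightarrow> s n | _ \<Rightarrow> G i)"

lemma env_simps [simp]:
  "env G s (Vr n) = s n" "env G s Dom = G Dom" "env G s (RS r) = G (RS r)" "env G s (FS f) = G (FS f)"
  by (simp_all add: env_def)

lemma env_upd: "env G (s(x := a)) = (env G s)(Vr x := a)"
  by (auto simp: env_def fun_eq_iff split: idx.split)

lemma env_comp: "env (j \<circ> G) (j \<circ> s) = (\<lambda>i. j (env G s i))"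
  by (auto simp: env_def fun_eq_iff split: idx.split)

lemma env_mem: "range G \<subseteq> A \<Longrightarrow> range s \<subseteq> A \<Longrightarrow> env G s i \<in> A"
  by (auto simp: env_def split: idx.split)

text \<open>The sets \<open>G Dom\<close>, \<open>G (RS r)\<close> and \<open>G (FS f)\<close> code an isomorphic copy of the structure
  \<open>U\<close>, with isomorphism \<open>h\<close>.\<close>
definition represents ::
    "'v::zfc language \<Rightarrow> 'v set \<Rightarrow> ('v idx \<Rightarrow> 'v) \<Rightarrow> ('v \<Rightarrow> 'v) \<Rightarrow> 'v struc \<Rightarrow> bool" where
  "represents \<tau> A G h U \<longleftrightarrow> insert_closed A \<and> range G \<subseteq> A \<and> is_struc \<tau> U \<and>
     bij_betw h (elts (G Dom)) (elts (dom U)) \<and>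
     (\<forall>r\<in>elts (rel_syms \<tau>). \<forall>as. length as = rel_arity \<tau> r \<and> set as \<subseteq> elts (G Dom) \<longrightarrow>
        (rel_int U r (map h as) \<longleftrightarrow> tup as \<in> elts (G (RS r)))) \<and>
     (\<forall>f\<in>elts (fun_syms \<tau>). \<forall>as. \<forall>v\<in>elts (G Dom).
        length as = fun_arity \<tau> f \<and> set as \<subseteq> elts (G Dom) \<longrightarrow>
        (fun_int U f (map h as) = h v \<longleftrightarrow> kpair v (tup as) \<in> elts (G (FS f))))"

lemma tm_val_closed:
  assumes "is_struc \<tau> U" "range s \<subseteq> elts (dom U)"
  shows "is_tm \<tau> t \<Longrightarrow> tm_val U s t \<in> elts (dom U)"
proof (induction t)
  case (Var x)
  then show ?case using assms(2) by auto
next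
  case (Fn f ts)
  then have "set (map (tm_val U s) ts) \<subseteq> elts (dom U)" by auto
  then show ?case using assms(1) Fn.prems unfolding is_struc_def by simp
qed

lemma bij_betw_lists:
  assumes "bij_betw h X Y" "set bs \<subseteq> Y"
  obtains as where "set as \<subseteq> X" "map h as = bs"
proof -
  have "set (map (inv_into X h) bs) \<subseteq> X" "map h (map (inv_into X h) bs) = bs"
    using assms by (auto simp: bij_betw_def inv_into_into f_inv_into_f subset_iff map_idI)
  then show ?thesis using that by blast
qed

context
  fixes \<tau> :: "'v::zfc language" and A G h U
  assumes rep: "represents \<tau> A G h U"
begin

lemma represents_closed: "insert_closed A"
  and represents_par: "G i \<in> A"
  and represents_struc: "is_struc \<tau> U"
  and represents_bij: "bij_betw h (elts (G Dom)) (elts (dom U))"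
  using rep by (auto simp: represents_def)

lemma represents_rel:
  "r \<in> elts (rel_syms \<tau>) \<Longrightarrow> length as = rel_arity \<tau> r \<Longrightarrow> set as \<subseteq> elts (G Dom) \<Longrightarrow>
     rel_int U r (map h as) \<longleftrightarrow> tup as \<in> elts (G (RS r))"
  using rep by (auto simp: represents_def)

lemma represents_fun:
  "f \<in> elts (fun_syms \<tau>) \<Longrightarrow> length as = fun_arity \<tau> f \<Longrightarrow> set as \<subseteq> elts (G Dom) \<Longrightarrow>
     v \<in> elts (G Dom) \<Longrightarrow> fun_int U f (map h as) = h v \<longleftrightarrow> kpair v (tup as) \<in> elts (G (FS f))"
  using rep by (auto simp: represents_def)

lemma represents_Dom: "a \<in> elts (G Dom) \<Longrightarrow> a \<in> A"
  using insert_closed_elts[OF represents_closed represents_par] .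

lemma represents_inj: "a \<in> elts (G Dom) \<Longrightarrow> b \<in> elts (G Dom) \<Longrightarrow> h a = h b \<longleftrightarrow> a = b"
  using represents_bij by (auto simp: bij_betw_def inj_on_def)

lemma represents_range: "range s \<subseteq> elts (G Dom) \<Longrightarrow> range (h \<circ> s) \<subseteq> elts (dom U)"
  using bij_betwE[OF represents_bij] by auto

end

section \<open>Translation of terms\<close>

text \<open>The language of sets has no function symbols, so a term becomes a formula for the graph
  of its value, held in the slot \<open>None\<close>. \<open>Q\<close> is chosen before
  \<open>A\<close>, \<open>G\<close>, \<open>h\<close> and \<open>U\<close>: the same formula works
  in both models.\<close>

definition defines_tm ::
    "'v::zfc language \<Rightarrow> ('v set \<Rightarrow> ('v idx option \<Rightarrow> 'v) \<Rightarrow> bool) \<Rightarrow> 'v tm \<Rightarrow> bool" where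
  "defines_tm \<tau> Q t \<longleftrightarrow> fmla Q \<and> (\<forall>A G h U s v. represents \<tau> A G h U \<longrightarrow> range s \<subseteq> elts (G Dom) \<longrightarrow>
     v \<in> A \<longrightarrow> (Q A (case_option v (env G s)) \<longleftrightarrow> v \<in> elts (G Dom) \<and> h v = tm_val U (h \<circ> s) t))"

definition defines_tms ::
    "'v::zfc language \<Rightarrow> ('v set \<Rightarrow> ('v idx option \<Rightarrow> 'v) \<Rightarrow> bool) \<Rightarrow> 'v tm list \<Rightarrow> bool" where
  "defines_tms \<tau> Q ts \<longleftrightarrow> fmla Q \<and> (\<forall>A G h U s w. represents \<tau> A G h U \<longrightarrow> range s \<subseteq> elts (G Dom) \<longrightarrow>
     w \<in> A \<longrightarrow> (Q A (case_option w (env G s)) \<longleftrightarrow> (\<exists>as. set as \<subseteq> elts (G Dom) \<and> w = tup as \<and>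
       map h as = map (tm_val U (h \<circ> s)) ts)))"

text \<open>Separate because terms are nested through lists: its premise is exactly what the
  induction over terms supplies in the case \<open>Fn\<close>.\<close>

lemma exists_defines_tms:
  fixes ts :: "'v::zfc tm list"
  assumes "\<And>t. t \<in> set ts \<Longrightarrow> \<exists>Q. defines_tm \<tau> Q t"
  shows "\<exists>Q. defines_tms \<tau> Q ts"
  using assms
proof (induction ts)
  case Nil
  have "fmla (\<lambda>A (e :: 'v idx option \<Rightarrow> 'v). is_empty A (e None))" by (rule fmla_is_empty)
  moreover have "is_empty A w \<longleftrightarrow> w = vset {}" if "represents \<tau> A G h U" "w \<in> A" for A G h U w
    using is_empty_iff[OF represents_closed[OF that(1)] that(2)] .
  ultimately have "defines_tms \<tau> (\<lambda>A e. is_empty A (e None)) []"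
    unfolding defines_tms_def by simp
  then show ?case by blast
next
  case (Cons t ts)
  obtain Q where Q: "defines_tm \<tau> Q t" using Cons.prems by auto
  obtain R where R: "defines_tms \<tau> R ts" using Cons by auto
  have fmla: "fmla Q" "fmla R" using Q R by (auto simp: defines_tm_def defines_tms_def)
  let ?P = "\<lambda>A e. \<exists>v\<in>A. \<exists>w\<in>A. Q A (case_option v (\<lambda>i. e (Some i))) \<and>
    R A (case_option w (\<lambda>i. e (Some i))) \<and> is_kpair A (e None) v w"
  have "fmla ?P"
    by (intro fmla_intros fmla_case_option[OF fmla(1)] fmla_case_option[OF fmla(2)] fmla_notions)
  moreover have "?P A (case_option w (env G s)) \<longleftrightarrow> (\<exists>as. set as \<subseteq> elts (G Dom) \<and> w = tup as \<and>
      map h as = map (tm_val U (h \<circ> s)) (t # ts))" (is "?l = ?r")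
    if rep: "represents \<tau> A G h U" and s: "range s \<subseteq> elts (G Dom)" and w: "w \<in> A" for A G h U s w
  proof -
    have Q': "Q A (case_option v (env G s)) \<longleftrightarrow> v \<in> elts (G Dom) \<and> h v = tm_val U (h \<circ> s) t"
      if "v \<in> A" for v
      using Q rep s that unfolding defines_tm_def by blast
    have R': "R A (case_option w (env G s)) \<longleftrightarrow> (\<exists>as. set as \<subseteq> elts (G Dom) \<and> w = tup as \<and>
        map h as = map (tm_val U (h \<circ> s)) ts)"
      if "w \<in> A" for w
      using R rep s that unfolding defines_tms_def by blast
    note closed = represents_closed[OF rep]
    show ?thesis
    proof
      assume ?l
      then obtain v as where "v \<in> elts (G Dom)" "h v = tm_val U (h \<circ> s) t" "set as \<subseteq> elts (G Dom)"
        "map h as = map (tm_val U (h \<circ> s)) ts" "w = kpair v (tup as)"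
        using Q' R' is_kpair_iff[OF closed w] by auto
      then show ?r by (intro exI[of _ "v # as"]) simp
    next
      assume ?r
      then obtain v as where *: "v \<in> elts (G Dom)" "h v = tm_val U (h \<circ> s) t" "set as \<subseteq> elts (G Dom)"
        "map h as = map (tm_val U (h \<circ> s)) ts" "w = kpair v (tup as)"
        by (auto simp: Cons_eq_map_conv map_eq_Cons_conv)
      moreover have "v \<in> A" "tup as \<in> A"
        using represents_Dom[OF rep] tup_closed[OF closed] * by auto
      ultimately show ?l using Q' R' is_kpair_iff[OF closed w] by auto
    qed
  qed
  ultimately have "defines_tms \<tau> ?P (t # ts)" unfolding defines_tms_def by blast
  then show ?case by blast
qed

lemma exists_defines_tm:
  fixes t :: "'v::zfc tm"
  shows "is_tm \<tau> t \<Longrightarrow> \<exists>Q. defines_tm \<tau> Q t"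
proof (induction t)
  case (Var x)
  have "fmla (\<lambda>A (e :: 'v idx option \<Rightarrow> 'v). e None = e (Some (Vr x)))" by (rule fmla_eq)
  moreover have "v = s x \<longleftrightarrow> v \<in> elts (G Dom) \<and> h v = h (s x)"
    if "represents \<tau> A G h U" "range s \<subseteq> elts (G Dom)" for A G h U s v
    using represents_inj[OF that(1), of v "s x"] that(2) by blast
  ultimately have "defines_tm \<tau> (\<lambda>A e. e None = e (Some (Vr x))) (Var x)"
    unfolding defines_tm_def by simp
  then show ?case by blast
next
  case (Fn f ts)
  then obtain R where R: "defines_tms \<tau> R ts"
    using exists_defines_tms[of ts \<tau>] by auto
  then have fmla: "fmla R" by (simp add: defines_tms_def)
  let ?P = "\<lambda>A e. e None \<in> elts (e (Some Dom)) \<and> (\<exists>w\<in>A. R A (case_option w (\<lambda>i. e (Some i))) \<and>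
    (\<exists>z\<in>A. is_kpair A z (e None) w \<and> z \<in> elts (e (Some (FS f)))))"
  have "fmla ?P"
    by (intro fmla_intros fmla_case_option[OF fmla] fmla_notions)
  moreover have "?P A (case_option v (env G s)) \<longleftrightarrow> v \<in> elts (G Dom) \<and> h v = tm_val U (h \<circ> s) (Fn f ts)"
    (is "?l = ?r")
    if rep: "represents \<tau> A G h U" and s: "range s \<subseteq> elts (G Dom)" and v: "v \<in> A" for A G h U s v
  proof -
    note closed = represents_closed[OF rep]
    let ?bs = "map (tm_val U (h \<circ> s)) ts"
    have bs: "set ?bs \<subseteq> elts (dom U)"
      using tm_val_closed[OF represents_struc[OF rep] represents_range[OF rep s]] Fn.prems by auto
    obtain as where as: "set as \<subseteq> elts (G Dom)" "map h as = ?bs"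
      using bij_betw_lists[OF represents_bij[OF rep] bs] .
    \<comment> \<open>As \<open>h\<close> is injective, the argument list has just one preimage, and
      the existential in \<open>defines_tms\<close> collapses to \<open>w = tup as\<close>.\<close>
    have as_uniq: "as' = as" if "set as' \<subseteq> elts (G Dom)" "map h as' = ?bs" for as'
      using that as inj_on_map_eq_map[of h as' as] represents_bij[OF rep]
      by (metis Un_least bij_betw_def inj_on_subset)
    have len: "length as = fun_arity \<tau> f"
      using arg_cong[OF as(2), of length] Fn.prems by simp
    have asA: "set as \<subseteq> A" using as(1) represents_Dom[OF rep] by auto
    have R': "R A (case_option w (env G s)) \<longleftrightarrow> w = tup as" if "w \<in> A" for w
      using R rep s that as as_uniq unfolding defines_tms_def by blast
    have "?l \<longleftrightarrow> v \<in> elts (G Dom) \<and> kpair v (tup as) \<in> elts (G (FS f))"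
      using R' tup_closed[OF closed asA] is_kpair_iff[OF closed _ v] kpair_closed[OF closed v]
      by auto
    also have "\<dots> \<longleftrightarrow> v \<in> elts (G Dom) \<and> fun_int U f ?bs = h v"
      using represents_fun[OF rep _ len as(1), of v] Fn.prems as(2) by auto
    finally show ?thesis by auto
  qed
  ultimately have "defines_tm \<tau> ?P (Fn f ts)" unfolding defines_tm_def by blast
  then show ?case by blast
qed

section \<open>Translation of formulas\<close>

text \<open>Tied to one representation, unlike \<open>defines_tm\<close>: the Haertig case is
  available only where the extents are known to have cardinals in the model.\<close>

definition expresses ::
    "'v::zfc set \<Rightarrow> ('v idx \<Rightarrow> 'v) \<Rightarrow> ('v \<Rightarrow> 'v) \<Rightarrow> 'v struc \<Rightarrow> ('v set \<Rightarrow> ('v idx \<Rightarrow> 'v) \<Rightarrow> bool) \<Rightarrow>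
      'v fm \<Rightarrow> bool" where
  "expresses A G h U Q \<phi> \<longleftrightarrow>
     (\<forall>s. range s \<subseteq> elts (G Dom) \<longrightarrow> (Q A (env G s) \<longleftrightarrow> sat U \<phi> (h \<circ> s)))"

lemma expresses_Eq:
  fixes t u :: "'v::zfc tm"
  assumes "is_tm \<tau> t" "is_tm \<tau> u"
  shows "\<exists>Q. fmla Q \<and> (\<forall>A G h U. represents \<tau> A G h U \<longrightarrow> expresses A G h U Q (Eq t u))"
proof -
  obtain Q R where Q: "defines_tm \<tau> Q t" and R: "defines_tm \<tau> R u"
    using exists_defines_tm assms by blast
  then have fmla: "fmla Q" "fmla R" by (auto simp: defines_tm_def)
  let ?P = "\<lambda>A e. \<exists>v\<in>A. Q A (case_option v (\<lambda>i. e i)) \<and> R A (case_option v (\<lambda>i. e i))"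
  have "fmla ?P"
    by (intro fmla_intros fmla_case_option[OF fmla(1)] fmla_case_option[OF fmla(2)])
  moreover have "expresses A G h U ?P (Eq t u)" if rep: "represents \<tau> A G h U" for A G h U
    unfolding expresses_def
  proof (intro allI impI)
    fix s :: "nat \<Rightarrow> 'v" assume s: "range s \<subseteq> elts (G Dom)"
    have Q': "Q A (case_option v (env G s)) \<longleftrightarrow> v \<in> elts (G Dom) \<and> h v = tm_val U (h \<circ> s) t"
      if "v \<in> A" for v
      using Q rep s that unfolding defines_tm_def by blast
    have R': "R A (case_option v (env G s)) \<longleftrightarrow> v \<in> elts (G Dom) \<and> h v = tm_val U (h \<circ> s) u"
      if "v \<in> A" for v
      using R rep s that unfolding defines_tm_def by blast
    have "tm_val U (h \<circ> s) t \<in> elts (dom U)"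
      using tm_val_closed[OF represents_struc[OF rep] represents_range[OF rep s] assms(1)] .
    then obtain v where "v \<in> elts (G Dom)" "tm_val U (h \<circ> s) t = h v"
      using represents_bij[OF rep] by (auto simp: bij_betw_def)
    moreover have "v \<in> A" using \<open>v \<in> elts (G Dom)\<close> represents_Dom[OF rep] by blast
    ultimately show "?P A (env G s) \<longleftrightarrow> sat U (Eq t u) (h \<circ> s)"
      using Q' R' by auto
  qed
  ultimately show ?thesis by blast
qed

lemma expresses_Rel:
  fixes ts :: "'v::zfc tm list"
  assumes r: "r \<in> elts (rel_syms \<tau>)" "length ts = rel_arity \<tau> r" and ts: "\<And>t. t \<in> set ts \<Longrightarrow> is_tm \<tau> t"
  shows "\<exists>Q. fmla Q \<and> (\<forall>A G h U. represents \<tau> A G h U \<longrightarrow> expresses A G h U Q (Rel r ts))"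
proof -
  obtain R where R: "defines_tms \<tau> R ts"
    using exists_defines_tms exists_defines_tm ts by blast
  then have fmla: "fmla R" by (auto simp: defines_tms_def)
  let ?P = "\<lambda>A e. \<exists>w\<in>A. R A (case_option w (\<lambda>i. e i)) \<and> w \<in> elts (e (RS r))"
  have "fmla ?P"
    by (intro fmla_intros fmla_case_option[OF fmla])
  moreover have "expresses A G h U ?P (Rel r ts)" if rep: "represents \<tau> A G h U" for A G h U
    unfolding expresses_def
  proof (intro allI impI)
    fix s :: "nat \<Rightarrow> 'v" assume s: "range s \<subseteq> elts (G Dom)"
    let ?bs = "map (tm_val U (h \<circ> s)) ts"
    have bs: "set ?bs \<subseteq> elts (dom U)"
      using tm_val_closed[OF represents_struc[OF rep] represents_range[OF rep s] ts] by auto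
    obtain as where as: "set as \<subseteq> elts (G Dom)" "map h as = ?bs"
      using bij_betw_lists[OF represents_bij[OF rep] bs] .
    have as_uniq: "as' = as" if "set as' \<subseteq> elts (G Dom)" "map h as' = ?bs" for as'
      using that as inj_on_map_eq_map[of h as' as] represents_bij[OF rep]
      by (metis Un_least bij_betw_def inj_on_subset)
    have len: "length as = rel_arity \<tau> r"
      using arg_cong[OF as(2), of length] r by simp
    have R': "R A (case_option w (env G s)) \<longleftrightarrow> w = tup as" if "w \<in> A" for w
      using R rep s that as as_uniq unfolding defines_tms_def by blast
    have "set as \<subseteq> A" using as(1) represents_Dom[OF rep] by auto
    then have "?P A (env G s) \<longleftrightarrow> tup as \<in> elts (G (RS r))"
      using R' tup_closed[OF represents_closed[OF rep]] by auto
    then show "?P A (env G s) \<longleftrightarrow> sat U (Rel r ts) (h \<circ> s)"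
      using represents_rel[OF rep r(1) len as(1)] as(2) by simp
  qed
  ultimately show ?thesis by blast
qed

lemma expresses_Neg:
  "expresses A G h U Q \<phi> \<Longrightarrow> expresses A G h U (\<lambda>A e. \<not> Q A e) (Neg \<phi>)"
  by (simp add: expresses_def)

lemma expresses_And:
  "expresses A G h U Q \<phi> \<Longrightarrow> expresses A G h U R \<psi> \<Longrightarrow>
     expresses A G h U (\<lambda>A e. Q A e \<and> R A e) (And \<phi> \<psi>)"
  by (simp add: expresses_def)

lemma expresses_upd:
  assumes rep: "represents \<tau> A G h U" and Q: "expresses A G h U Q \<phi>"
    and s: "range s \<subseteq> elts (G Dom)" and a: "a \<in> elts (G Dom)"
  shows "Q A ((env G s)(Vr x := a)) \<longleftrightarrow> sat U \<phi> ((h \<circ> s)(x := h a))"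
proof -
  have "h \<circ> s(x := a) = (h \<circ> s)(x := h a)" by (auto simp: fun_eq_iff)
  moreover have "range (s(x := a)) \<subseteq> elts (G Dom)" using s a by auto
  ultimately show ?thesis using Q unfolding expresses_def by (metis env_upd)
qed

lemma expresses_Ex:
  assumes rep: "represents \<tau> A G h U" and Q: "expresses A G h U Q \<phi>"
  shows "expresses A G h U (\<lambda>A e. \<exists>a\<in>A. a \<in> elts (e Dom) \<and> Q A ((\<lambda>i. e i)(Vr x := a))) (Ex x \<phi>)"
  unfolding expresses_def
proof (intro allI impI)
  fix s :: "nat \<Rightarrow> 'a" assume s: "range s \<subseteq> elts (G Dom)"
  have "elts (dom U) = h ` elts (G Dom)" using represents_bij[OF rep] by (auto simp: bij_betw_def)
  then show "(\<exists>a\<in>A. a \<in> elts (env G s Dom) \<and> Q A ((env G s)(Vr x := a))) \<longleftrightarrow> sat U (Ex x \<phi>) (h \<circ> s)"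
    using represents_Dom[OF rep] expresses_upd[OF rep Q s] by auto
qed

definition is_extent :: "('v::zfc set \<Rightarrow> ('v idx \<Rightarrow> 'v) \<Rightarrow> bool) \<Rightarrow> nat \<Rightarrow> 'v set \<Rightarrow> ('v idx \<Rightarrow> 'v) \<Rightarrow> 'v \<Rightarrow> bool" where
  "is_extent Q x A e D \<longleftrightarrow> (\<forall>a\<in>A. a \<in> elts D \<longleftrightarrow> a \<in> elts (e Dom) \<and> Q A (e(Vr x := a)))"

text \<open>The statement that has to be carried from \<open>Vlevel \<alpha>\<close> to
  \<open>M\<close> before the Haertig quantifier can be evaluated there.\<close>

definition extent_has_card :: "('v::zfc set \<Rightarrow> ('v idx \<Rightarrow> 'v) \<Rightarrow> bool) \<Rightarrow> nat \<Rightarrow> 'v set \<Rightarrow> ('v idx \<Rightarrow> 'v) \<Rightarrow> bool" where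
  "extent_has_card Q x A e \<longleftrightarrow> (\<exists>D\<in>A. is_extent Q x A (\<lambda>i. e i) D \<and>
     (\<exists>k\<in>A. \<exists>f\<in>A. is_Card A k \<and> is_bij A f D k))"

text \<open>Comparing both extents with a common \<open>k\<close> means that no bijection between
  \<open>D\<close> and \<open>E\<close> themselves has to be found inside the model; one in the
  universe is enough, by correctness.\<close>

definition same_card :: "('v::zfc set \<Rightarrow> ('v idx \<Rightarrow> 'v) \<Rightarrow> bool) \<Rightarrow> nat \<Rightarrow>
    ('v set \<Rightarrow> ('v idx \<Rightarrow> 'v) \<Rightarrow> bool) \<Rightarrow> nat \<Rightarrow> 'v set \<Rightarrow> ('v idx \<Rightarrow> 'v) \<Rightarrow> bool" where
  "same_card Q x R y A e \<longleftrightarrow> (\<exists>D\<in>A. \<exists>E\<in>A. is_extent Q x A (\<lambda>i. e i) D \<and> is_extent R y A (\<lambda>i. e i) E \<and>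
     (\<exists>k\<in>A. \<exists>f\<in>A. \<exists>g\<in>A. is_bij A f D k \<and> is_bij A g E k))"

lemma fmla_is_extent: "fmla Q \<Longrightarrow> fmla (\<lambda>A e. is_extent Q x A (\<lambda>i. e (r i)) (e k))"
  unfolding is_extent_def by (intro fmla_intros fmla_upd)

lemma fmla_extent_has_card: "fmla Q \<Longrightarrow> fmla (extent_has_card Q x)"
  unfolding extent_has_card_def[abs_def] by (intro fmla_intros fmla_is_extent fmla_notions)

lemma fmla_same_card: "fmla Q \<Longrightarrow> fmla R \<Longrightarrow> fmla (same_card Q x R y)"
  unfolding same_card_def[abs_def] by (intro fmla_intros fmla_is_extent fmla_notions)

lemma is_extent_elts:
  assumes rep: "represents \<tau> A G h U" and Q: "expresses A G h U Q \<phi>"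
    and s: "range s \<subseteq> elts (G Dom)" and "D \<in> A" "is_extent Q x A (env G s) D"
  shows "{b \<in> elts (dom U). sat U \<phi> ((h \<circ> s)(x := b))} \<approx> elts D"
proof -
  have "elts D = {a \<in> elts (G Dom). Q A ((env G s)(Vr x := a))}"
    using assms(5) represents_Dom[OF rep] insert_closed_elts[OF represents_closed[OF rep] \<open>D \<in> A\<close>]
    unfolding is_extent_def by auto
  also have "\<dots> = {a \<in> elts (G Dom). sat U \<phi> ((h \<circ> s)(x := h a))}"
    using expresses_upd[OF rep Q s] by blast
  finally have D: "elts D = {a \<in> elts (G Dom). sat U \<phi> ((h \<circ> s)(x := h a))}" .
  have "elts (dom U) = h ` elts (G Dom)" using represents_bij[OF rep] by (auto simp: bij_betw_def)
  then have "h ` elts D = {b \<in> elts (dom U). sat U \<phi> ((h \<circ> s)(x := b))}"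
    unfolding D by auto
  moreover have "inj_on h (elts D)"
    using represents_bij[OF rep] unfolding D by (auto simp: bij_betw_def inj_on_def)
  ultimately have "elts D \<approx> {b \<in> elts (dom U). sat U \<phi> ((h \<circ> s)(x := b))}"
    unfolding eqpoll_def bij_betw_def by blast
  then show ?thesis by (rule eqpoll_sym)
qed

lemma expresses_Hartig:
  assumes rep: "represents \<tau> A G h U" and A: "correct_class A"
    and Q: "expresses A G h U Q \<phi>" and R: "expresses A G h U R \<psi>"
    and card: "\<And>s. range s \<subseteq> elts (G Dom) \<Longrightarrow> extent_has_card Q x A (env G s)"
      "\<And>s. range s \<subseteq> elts (G Dom) \<Longrightarrow> extent_has_card R y A (env G s)"
  shows "expresses A G h U (same_card Q x R y) (Hartig x y \<phi> \<psi>)"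
  unfolding expresses_def
proof (intro allI impI)
  fix s :: "nat \<Rightarrow> 'a" assume s: "range s \<subseteq> elts (G Dom)"
  let ?X = "{a \<in> elts (dom U). sat U \<phi> ((h \<circ> s)(x := a))}"
  let ?Y = "{b \<in> elts (dom U). sat U \<psi> ((h \<circ> s)(y := b))}"
  note closed = represents_closed[OF rep]
  have "same_card Q x R y A (env G s) \<longleftrightarrow> ?X \<approx> ?Y"
  proof
    assume "same_card Q x R y A (env G s)"
    then obtain D E k f g where *: "D \<in> A" "E \<in> A" "k \<in> A" "is_extent Q x A (env G s) D"
      "is_extent R y A (env G s) E" "is_bij A f D k" "is_bij A g E k"
      by (auto simp: same_card_def)
    have "?X \<approx> elts D" "?Y \<approx> elts E"
      using is_extent_elts[OF rep Q s] is_extent_elts[OF rep R s] * by blast+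
    moreover have "elts D \<approx> elts k" "elts E \<approx> elts k"
      using is_bij_eqpoll[OF closed] * by blast+
    ultimately show "?X \<approx> ?Y" by (meson eqpoll_sym eqpoll_trans)
  next
    assume XY: "?X \<approx> ?Y"
    obtain D k f where D: "D \<in> A" "k \<in> A" "f \<in> A" "is_extent Q x A (env G s) D" "is_Card A k"
      "is_bij A f D k"
      using card(1)[OF s] by (auto simp: extent_has_card_def)
    obtain E l g where E: "E \<in> A" "l \<in> A" "g \<in> A" "is_extent R y A (env G s) E" "is_Card A l"
      "is_bij A g E l"
      using card(2)[OF s] by (auto simp: extent_has_card_def)
    have "?X \<approx> elts D" "?Y \<approx> elts E"
      using is_extent_elts[OF rep Q s] is_extent_elts[OF rep R s] D E by blast+
    moreover have "elts D \<approx> elts k" "elts E \<approx> elts l"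
      using is_bij_eqpoll[OF closed] D E by blast+
    ultimately have "elts k \<approx> elts l" using XY by (meson eqpoll_sym eqpoll_trans)
    \<comment> \<open>Correctness turns equinumerosity in the universe into the equality
      \<open>k = l\<close>, and so into something that the model sees.\<close>
    moreover have "Card k" "Card l" using A D E by (auto simp: correct_class_def)
    ultimately have "k = l" using Card_unique by blast
    then show "same_card Q x R y A (env G s)" using D E unfolding same_card_def by blast
  qed
  then show "same_card Q x R y A (env G s) \<longleftrightarrow> sat U (Hartig x y \<phi> \<psi>) (h \<circ> s)" by simp
qed

text \<open>The universal closure of a definable predicate is a first-order statement because only
  finitely many variables matter.\<close>
lemma fmla_transfer_universal:
  assumes j: "elementary_embedding j A B" and G: "range G \<subseteq> A" "elts (G Dom) \<subseteq> A" "elts (G Dom) \<noteq> {}"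
    and B: "elts (j (G Dom)) \<subseteq> B"
    and P: "fmla P" "\<And>s. range s \<subseteq> elts (G Dom) \<Longrightarrow> P A (env G s)"
    and t: "range t \<subseteq> elts (j (G Dom))"
  shows "P B (env (j \<circ> G) t)"
proof -
  obtain a where a: "a \<in> elts (G Dom)" using G(3) by blast
  have ja: "j a \<in> elts (j (G Dom))"
    using fmla_transfer[OF j fmla_mem[of False True], of "case_bool (G Dom) a"] a G
    by (simp add: range_subsetD subsetD split: bool.split)
  \<comment> \<open>Induction on a set \<open>I\<close> of variables outside of which
    \<open>t\<close> has the default value \<open>j a\<close>. For empty \<open>I\<close> the whole
    assignment is the image of a constant one, so elementarity applies directly.\<close>
  have closed: "P B (env (j \<circ> G) t)"
    if "finite I" "fmla P" "\<forall>s. range s \<subseteq> elts (G Dom) \<longrightarrow> P A (env G s)"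
      "range t \<subseteq> elts (j (G Dom))" "\<forall>n. n \<notin> I \<longrightarrow> t n = j a" for I P t
    using that
  proof (induction I arbitrary: P t rule: finite_induct)
    case empty
    then have "P A (env G (\<lambda>n. a))" using a by auto
    moreover have "env G (\<lambda>n. a) i \<in> A" for i
      by (rule env_mem[OF G(1)]) (use a G(2) in auto)
    ultimately have "P B (\<lambda>i. j (env G (\<lambda>n. a) i))"
      using fmla_transfer[OF j empty.prems(1), of "env G (\<lambda>n. a)"] by simp
    moreover have "t = j \<circ> (\<lambda>n. a)" using empty.prems by auto
    ultimately show ?case by (simp only: env_comp)
  next
    case (insert n I)
    \<comment> \<open>The variable \<open>n\<close> is moved from the assignment into the formula;
      afterwards the quantifier is instantiated at \<open>t n\<close>, which may lie outside the
      range of \<open>j\<close>.\<close>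
    let ?P = "\<lambda>A e. \<forall>b\<in>A. b \<in> elts (e Dom) \<longrightarrow> P A ((\<lambda>i. e i)(Vr n := b))"
    have "fmla ?P" by (intro fmla_intros fmla_upd insert.prems)
    moreover have "\<forall>s. range s \<subseteq> elts (G Dom) \<longrightarrow> ?P A (env G s)"
    proof (intro allI impI ballI)
      fix s :: "nat \<Rightarrow> 'a" and b assume "range s \<subseteq> elts (G Dom)" "b \<in> elts (env G s Dom)"
      then have "range (s(n := b)) \<subseteq> elts (G Dom)" by auto
      then show "P A ((env G s)(Vr n := b))" using insert.prems(2) env_upd by metis
    qed
    moreover have "range (t(n := j a)) \<subseteq> elts (j (G Dom))" using insert.prems(3) ja by auto
    moreover have "\<forall>m. m \<notin> I \<longrightarrow> (t(n := j a)) m = j a" using insert.prems(4) by auto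
    ultimately have "?P B (env (j \<circ> G) (t(n := j a)))" by (rule insert.IH)
    moreover have "t n \<in> elts (j (G Dom))" using insert.prems(3) by auto
    ultimately have "P B ((env (j \<circ> G) (t(n := j a)))(Vr n := t n))" using B by auto
    moreover have "(env (j \<circ> G) (t(n := j a)))(Vr n := t n) = env (j \<circ> G) t"
      by (simp only: env_upd[symmetric] fun_upd_upd fun_upd_triv)
    ultimately show ?case by (simp only:)
  qed
  obtain I where I: "finite I" "\<And>A e e'. (\<forall>i\<in>I. e i = e' i) \<Longrightarrow> P A e = P A e'"
    using fmla_support[OF P(1)] by blast
  define t' where "t' n = (if Vr n \<in> I then t n else j a)" for n
  have "finite {n. Vr n \<in> I}"
    using finite_vimageI[OF I(1), of Vr] by (simp add: vimage_def inj_def)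
  moreover have "range t' \<subseteq> elts (j (G Dom))" using t ja by (auto simp: t'_def)
  ultimately have "P B (env (j \<circ> G) t')"
    using closed[of "{n. Vr n \<in> I}" P t'] P by (simp add: t'_def)
  moreover have "P B (env (j \<circ> G) t') = P B (env (j \<circ> G) t)"
    by (rule I(2)[of "env (j \<circ> G) t'" "env (j \<circ> G) t"]) (auto simp: env_def t'_def split: idx.split)
  ultimately show ?thesis by blast
qed

text \<open>Both models are treated in one induction because the Haertig case transfers
  \<open>extent_has_card\<close> for the very formulas obtained for the two immediate
  subformulas.\<close>

lemma exists_expresses:
  fixes \<phi> :: "'v::zfc fm"
  assumes j: "elementary_embedding j A B"
    and A: "correct_class A" and B: "correct_class B"
    and rep: "represents \<tau> A G h U" "represents \<tau> B (j \<circ> G) k T"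
    and cards: "\<And>X. X \<subseteq> elts (G Dom) \<Longrightarrow>
      \<exists>D\<in>A. elts D = X \<and> (\<exists>k\<in>A. \<exists>f\<in>A. is_Card A k \<and> is_bij A f D k)"
  shows "is_fm \<tau> \<phi> \<Longrightarrow>
    \<exists>Q. fmla Q \<and> expresses A G h U Q \<phi> \<and> expresses B (j \<circ> G) k T Q \<phi>"
proof (induction \<phi>)
  case (Eq t u)
  then show ?case using expresses_Eq[of \<tau> t u] rep by (metis is_fm.simps(1))
next
  case (Rel r ts)
  then show ?case using expresses_Rel[of r \<tau> ts] rep by (metis is_fm.simps(2))
next
  case (Neg \<phi>)
  then obtain Q where Q: "fmla Q" "expresses A G h U Q \<phi>" "expresses B (j \<circ> G) k T Q \<phi>"
    unfolding is_fm.simps by blast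
  show ?case using fmla_not[OF Q(1)] expresses_Neg[OF Q(2)] expresses_Neg[OF Q(3)] by blast
next
  case (And \<phi> \<psi>)
  then obtain Q R where Q: "fmla Q" "expresses A G h U Q \<phi>" "expresses B (j \<circ> G) k T Q \<phi>"
    and R: "fmla R" "expresses A G h U R \<psi>" "expresses B (j \<circ> G) k T R \<psi>"
    unfolding is_fm.simps by blast
  show ?case
    using fmla_conj[OF Q(1) R(1)] expresses_And[OF Q(2) R(2)] expresses_And[OF Q(3) R(3)] by blast
next
  case (Ex x \<phi>)
  then obtain Q where Q: "fmla Q" "expresses A G h U Q \<phi>" "expresses B (j \<circ> G) k T Q \<phi>"
    unfolding is_fm.simps by blast
  have "fmla (\<lambda>A e. \<exists>a\<in>A. a \<in> elts (e Dom) \<and> Q A ((\<lambda>i. e i)(Vr x := a)))"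
    by (intro fmla_intros fmla_upd Q)
  then show ?case using expresses_Ex[OF rep(1) Q(2)] expresses_Ex[OF rep(2) Q(3)] by blast
next
  case (Hartig x y \<phi> \<psi>)
  then obtain Q R where Q: "fmla Q" "expresses A G h U Q \<phi>" "expresses B (j \<circ> G) k T Q \<phi>"
    and R: "fmla R" "expresses A G h U R \<psi>" "expresses B (j \<circ> G) k T R \<psi>"
    unfolding is_fm.simps by blast
  have cardA: "extent_has_card Q x A (env G s)" if "range s \<subseteq> elts (G Dom)"
    for Q :: "'v set \<Rightarrow> ('v idx \<Rightarrow> 'v) \<Rightarrow> bool" and x s
  proof -
    obtain D where D: "D \<in> A" "elts D = {a \<in> elts (G Dom). Q A ((env G s)(Vr x := a))}"
      "\<exists>k\<in>A. \<exists>f\<in>A. is_Card A k \<and> is_bij A f D k"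
      using cards[of "{a \<in> elts (G Dom). Q A ((env G s)(Vr x := a))}"] by blast
    then have "is_extent Q x A (env G s) D" by (auto simp: is_extent_def)
    then show ?thesis using D by (auto simp: extent_has_card_def)
  qed
  have ne: "elts (G Dom) \<noteq> {}"
    using represents_struc[OF rep(1)] represents_bij[OF rep(1)] by (auto simp: is_struc_def bij_betw_def)
  \<comment> \<open>\<open>cardA\<close> holds for every predicate, as \<open>cards\<close> covers
    all subsets of \<open>G Dom\<close>. In \<open>B\<close> the predicate must be definable, and
    the universal transfer covers arbitrary parameters \<open>t\<close>.\<close>
  have cardB: "extent_has_card Q x B (env (j \<circ> G) t)"
    if "fmla Q" "range t \<subseteq> elts ((j \<circ> G) Dom)"
    for Q :: "'v set \<Rightarrow> ('v idx \<Rightarrow> 'v) \<Rightarrow> bool" and x t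
    using represents_par[OF rep(1)] represents_Dom[OF rep(1)] represents_Dom[OF rep(2)] that cardA ne
    by (intro fmla_transfer_universal[OF j _ _ _ _ fmla_extent_has_card]) auto
  show ?case
    using fmla_same_card[OF Q(1) R(1)] expresses_Hartig[OF rep(1) A Q(2) R(2) cardA cardA]
      expresses_Hartig[OF rep(2) B Q(3) R(3) cardB[OF Q(1)] cardB[OF R(1)]] by blast
qed

section \<open>Proper extensions\<close>

text \<open>One level below \<alpha> has to hold all tuples of length \<open>n\<close>, so that an
  entire graph becomes an element of \<open>Vlevel \<alpha>\<close>. Each Kuratowski pair costs two
  levels, so the bound depends on \<open>n\<close>.\<close>

lemma tuples_in_Vlevel:
  assumes \<alpha>: "limit_Ord \<alpha>" and \<gamma>: "\<gamma> \<in> elts \<alpha>"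
  shows "\<exists>\<beta>\<in>elts \<alpha>. \<forall>as. length as = n \<and> set as \<subseteq> Vlevel \<gamma> \<longrightarrow> tup as \<in> Vlevel \<beta>"
proof (induction n)
  case 0
  obtain \<beta> where "\<beta> \<in> elts \<alpha>" "vset {} \<in> Vlevel \<beta>"
    using limit_Vlevel_mem[OF \<alpha> insert_closed_empty[OF insert_closed_Vlevel[OF \<alpha>]]] by blast
  then show ?case by (intro bexI[of _ \<beta>]) auto
next
  case (Suc n)
  then obtain \<beta> where \<beta>: "\<beta> \<in> elts \<alpha>"
    "\<And>as. length as = n \<Longrightarrow> set as \<subseteq> Vlevel \<gamma> \<Longrightarrow> tup as \<in> Vlevel \<beta>" by blast
  obtain \<mu> where \<mu>: "\<mu> \<in> elts \<alpha>" "Vlevel \<beta> \<subseteq> Vlevel \<mu>" "Vlevel \<gamma> \<subseteq> Vlevel \<mu>"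
    using limit_Ord_max[OF \<alpha> \<beta>(1) \<gamma>] .
  have kpair: "kpair x y \<in> Vlevel (osucc (osucc \<mu>))" if "x \<in> Vlevel \<mu>" "y \<in> Vlevel \<mu>" for x y
    using that unfolding kpair_def by (intro Vlevel_osucc) (auto intro: Vlevel_osucc)
  have "tup as \<in> Vlevel (osucc (osucc \<mu>))" if as: "length as = Suc n" "set as \<subseteq> Vlevel \<gamma>" for as
  proof -
    obtain b bs where "as = b # bs" "length bs = n" using as(1) by (auto simp: length_Suc_conv)
    then show ?thesis using as \<beta>(2)[of bs] \<mu> kpair[of b "tup bs"] by auto
  qed
  moreover have "osucc (osucc \<mu>) \<in> elts \<alpha>" using \<alpha> \<mu>(1) by (auto simp: limit_Ord_def)
  ultimately show ?case by blast
qed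

text \<open>Agreement on the symbols is elementarity for atomic formulas whose arguments are
  distinct variables; \<open>val\<close> assigns a given list to the first variables and pads with
  \<open>a\<close>.\<close>

lemma LI_elementary_substructureI:
  fixes S T :: "'v::zfc struc"
  assumes S: "is_struc \<tau> S" and T: "is_struc \<tau> T" and sub: "elts (dom S) \<subseteq> elts (dom T)"
    and sat: "\<And>\<phi> s. is_fm \<tau> \<phi> \<Longrightarrow> range s \<subseteq> elts (dom S) \<Longrightarrow> sat S \<phi> s \<longleftrightarrow> sat T \<phi> s"
  shows "LI_elementary_substructure \<tau> S T"
proof -
  obtain a where a: "a \<in> elts (dom S)" using S by (auto simp: is_struc_def)
  define val where "val as n = (if n < length as then as ! n else a)" for as n
  have val: "range (val as) \<subseteq> elts (dom S)" if "set as \<subseteq> elts (dom S)" for as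
    using that a by (auto simp: val_def subset_iff)
  have map: "map (tm_val U (val as)) (map Var [0..<length as]) = as" for U as
    by (rule nth_equalityI) (auto simp: val_def)
  have "rel_int S r as \<longleftrightarrow> rel_int T r as"
    if r: "r \<in> elts (rel_syms \<tau>)" and as: "length as = rel_arity \<tau> r" "set as \<subseteq> elts (dom S)" for r as
  proof -
    let ?ts = "map Var [0..<length as] :: 'v tm list"
    have "is_fm \<tau> (Rel r ?ts)" using r as(1) by simp
    then have "sat S (Rel r ?ts) (val as) \<longleftrightarrow> sat T (Rel r ?ts) (val as)"
      using sat val[OF as(2)] by blast
    then show ?thesis by (simp only: sat.simps map)
  qed
  moreover have "fun_int S f as = fun_int T f as"
    if f: "f \<in> elts (fun_syms \<tau>)" and as: "length as = fun_arity \<tau> f" "set as \<subseteq> elts (dom S)" for f as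
  proof -
    \<comment> \<open>The value computed in \<open>S\<close> is stored in the next free variable, so
      that a single equation compares it with the value in \<open>T\<close>.\<close>
    let ?bs = "as @ [fun_int S f as]"
    let ?ts = "map Var [0..<length as] :: 'v tm list"
    let ?\<phi> = "Eq (Fn f ?ts) (Var (length as))"
    have "set ?bs \<subseteq> elts (dom S)" using S f as by (auto simp: is_struc_def)
    moreover have "is_fm \<tau> ?\<phi>" using f as by auto
    ultimately have "sat S ?\<phi> (val ?bs) \<longleftrightarrow> sat T ?\<phi> (val ?bs)" using sat val by blast
    moreover have "map (tm_val U (val ?bs)) ?ts = as" for U
      by (rule nth_equalityI) (auto simp: val_def nth_append)
    moreover have "val ?bs (length as) = fun_int S f as" by (simp add: val_def)
    ultimately show ?thesis by simp
  qed
  ultimately show ?thesis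
    using S T sub sat by (simp add: LI_elementary_substructure_def substructure_def)
qed

text \<open>Closure under insertion is expressed by a sentence and moves along \<open>j\<close>.
  Transitivity of \<open>M\<close> then ensures that the set which \<open>M\<close> takes for the
  result really is the result.\<close>

lemma elementary_insert_closed:
  assumes j: "elementary_embedding j A (elts M)" and A: "insert_closed A" and M: "transitive_set M"
  shows "insert_closed (elts M)"
proof -
  \<comment> \<open>A sentence: the environment over \<open>unit\<close> is a dummy.\<close>
  let ?P = "\<lambda>A (e :: unit \<Rightarrow> 'a). \<forall>x\<in>A. \<forall>y\<in>A. \<exists>z\<in>A. \<forall>u\<in>A. u \<in> elts z \<longleftrightarrow> u = x \<or> u \<in> elts y"
  obtain a where a: "a \<in> A" using A by (auto simp: insert_closed_def)
  have "?P A (\<lambda>_. a)"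
    using insert_closed_insert[OF A] by (intro ballI bexI[of _ "vset (insert _ (elts _))"]) auto
  moreover have "fmla ?P" by (intro fmla_intros)
  ultimately have "?P (elts M) (\<lambda>_. j a)" using fmla_transfer[OF j, of ?P "\<lambda>_. a"] a by simp
  then have *: "\<exists>z\<in>elts M. \<forall>u\<in>elts M. u \<in> elts z \<longleftrightarrow> u = x \<or> u \<in> elts y"
    if "x \<in> elts M" "y \<in> elts M" for x y
    using that by simp
  have trans: "y \<in> elts x \<Longrightarrow> x \<in> elts M \<Longrightarrow> y \<in> elts M" for x y
    using M by (auto simp: transitive_set_def)
  have "vset (insert x (elts y)) \<in> elts M" if xy: "x \<in> elts M" "y \<in> elts M" for x y
  proof -
    obtain z where z: "z \<in> elts M" "\<forall>u\<in>elts M. u \<in> elts z \<longleftrightarrow> u = x \<or> u \<in> elts y"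
      using *[OF xy] by (rule bexE)
    have "elts z \<subseteq> elts M" "insert x (elts y) \<subseteq> elts M" using trans z(1) xy by auto
    then have "elts z = insert x (elts y)" using z(2) by blast
    then have "z = vset (insert x (elts y))" by (simp add: eq_vset_iff)
    then show ?thesis using z(1) by simp
  qed
  moreover have "elts M \<noteq> {}" using j a by (auto simp: elementary_embedding_def)
  ultimately show ?thesis using trans by (auto simp: insert_closed_def)
qed

section \<open>Structures and their codes\<close>

text \<open>The converse of coding: a structure is read off from the parameters and moved along
  \<open>h\<close>, so that its domain can be made a superset of a prescribed one.\<close>

definition coded_struc :: "('v::zfc idx \<Rightarrow> 'v) \<Rightarrow> ('v \<Rightarrow> 'v) \<Rightarrow> 'v struc" where
  "coded_struc G h = \<lparr>dom = vset (h ` elts (G Dom)),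
     rel_int = (\<lambda>r bs. tup (map (inv_into (elts (G Dom)) h) bs) \<in> elts (G (RS r))),
     fun_int = (\<lambda>f bs. h (THE v. v \<in> elts (G Dom) \<and>
       kpair v (tup (map (inv_into (elts (G Dom)) h) bs)) \<in> elts (G (FS f))))\<rparr>"

lemma represents_coded_struc:
  assumes A: "insert_closed A" and G: "range G \<subseteq> A" and h: "inj_on h (elts (G Dom))"
    and ne: "elts (G Dom) \<noteq> {}"
    and functional: "\<And>f as. f \<in> elts (fun_syms \<tau>) \<Longrightarrow> length as = fun_arity \<tau> f \<Longrightarrow>
      set as \<subseteq> elts (G Dom) \<Longrightarrow> \<exists>!v. v \<in> elts (G Dom) \<and> kpair v (tup as) \<in> elts (G (FS f))"
  shows "represents \<tau> A G h (coded_struc G h)"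
proof -
  let ?U = "coded_struc G h"
  have dom: "elts (dom ?U) = h ` elts (G Dom)" by (simp add: coded_struc_def)
  have inv: "map (inv_into (elts (G Dom)) h) (map h as) = as" if "set as \<subseteq> elts (G Dom)" for as
    using that h by (auto intro!: map_idI inv_into_f_f simp: subset_iff)
  have fun_int: "\<exists>v\<in>elts (G Dom). fun_int ?U f (map h as) = h v \<and> kpair v (tup as) \<in> elts (G (FS f))
      \<and> (\<forall>v'\<in>elts (G Dom). kpair v' (tup as) \<in> elts (G (FS f)) \<longrightarrow> v' = v)"
    if "f \<in> elts (fun_syms \<tau>)" "length as = fun_arity \<tau> f" "set as \<subseteq> elts (G Dom)" for f as
  proof -
    note ex1 = functional[OF that]
    let ?v = "THE v. v \<in> elts (G Dom) \<and> kpair v (tup as) \<in> elts (G (FS f))"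
    have "fun_int ?U f (map h as) = h ?v" by (simp only: coded_struc_def struc.simps inv[OF that(3)])
    then show ?thesis using theI'[OF ex1] ex1 by blast
  qed
  have "is_struc \<tau> ?U"
    unfolding is_struc_def
  proof (intro conjI ballI allI impI)
    show "elts (dom ?U) \<noteq> {}" using dom ne by simp
    fix f bs assume f: "f \<in> elts (fun_syms \<tau>)" and bs: "length bs = fun_arity \<tau> f \<and> set bs \<subseteq> elts (dom ?U)"
    obtain as where as: "set as \<subseteq> elts (G Dom)" "map h as = bs"
      using bij_betw_lists[OF inj_on_imp_bij_betw[OF h]] bs dom by metis
    then have "length as = fun_arity \<tau> f" using bs by auto
    from fun_int[OF f this as(1)] as(2) dom show "fun_int ?U f bs \<in> elts (dom ?U)" by auto
  qed
  moreover have "rel_int ?U r (map h as) \<longleftrightarrow> tup as \<in> elts (G (RS r))"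
    if "set as \<subseteq> elts (G Dom)" for r as
    by (simp only: coded_struc_def struc.simps inv[OF that])
  moreover have "fun_int ?U f (map h as) = h v \<longleftrightarrow> kpair v (tup as) \<in> elts (G (FS f))"
    if f: "f \<in> elts (fun_syms \<tau>)" "length as = fun_arity \<tau> f" "set as \<subseteq> elts (G Dom)"
      and v: "v \<in> elts (G Dom)"
    for f as v
  proof -
    obtain u where "u \<in> elts (G Dom)" "fun_int ?U f (map h as) = h u" "kpair u (tup as) \<in> elts (G (FS f))"
      "\<forall>v'\<in>elts (G Dom). kpair v' (tup as) \<in> elts (G (FS f)) \<longrightarrow> v' = u"
      using fun_int[OF f] by blast
    moreover have "h u = h v \<longleftrightarrow> u = v" using h v \<open>u \<in> elts (G Dom)\<close> by (auto simp: inj_on_def)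
    ultimately show ?thesis using v by metis
  qed
  ultimately show ?thesis
    using A G h dom unfolding represents_def bij_betw_def by blast
qed

lemma exists_representation:
  fixes S :: "'v::zfc struc"
  assumes \<alpha>: "limit_Ord \<alpha>" and \<gamma>: "\<gamma> \<in> elts \<alpha>" and S: "is_struc \<tau> S"
    and h: "bij_betw h (elts \<gamma>) (elts (dom S))"
  shows "\<exists>G. G Dom = \<gamma> \<and> represents \<tau> (Vlevel \<alpha>) G h S"
proof -
  have Ord: "Ord \<alpha>" using \<alpha> by (simp add: limit_Ord_def)
  have \<gamma>V: "elts \<gamma> \<subseteq> Vlevel \<gamma>" using Ord_subset_Vlevel[OF Ord_mem[OF Ord \<gamma>]] .
  define R where "R r = {tup as | as. length as = rel_arity \<tau> r \<and> set as \<subseteq> elts \<gamma> \<and> rel_int S r (map h as)}" for r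
  \<comment> \<open>Placing the value in front makes the graph a set of ordinary tuples of length
    one more than the arity.\<close>
  define F where "F f = {tup (v # as) | v as. length as = fun_arity \<tau> f \<and> set as \<subseteq> elts \<gamma> \<and>
    v \<in> elts \<gamma> \<and> fun_int S f (map h as) = h v}" for f
  \<comment> \<open>The value at \<open>Vr n\<close> is a filler: \<open>env\<close> overrides it,
    but \<open>range G\<close> must lie in \<open>Vlevel \<alpha>\<close>.\<close>
  define G where "G i = (case i of Dom \<Rightarrow> \<gamma> | RS r \<Rightarrow> vset (R r) | FS f \<Rightarrow> vset (F f) | Vr n \<Rightarrow> \<gamma>)" for i
  have code: "vset Z \<in> Vlevel \<alpha> \<and> small Z"
    if Z: "\<And>z. z \<in> Z \<Longrightarrow> \<exists>as. z = tup as \<and> length as = n \<and> set as \<subseteq> elts \<gamma>" for Z n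
  proof -
    obtain \<beta> where \<beta>: "\<beta> \<in> elts \<alpha>" "\<And>as. length as = n \<Longrightarrow> set as \<subseteq> Vlevel \<gamma> \<Longrightarrow> tup as \<in> Vlevel \<beta>"
      using tuples_in_Vlevel[OF \<alpha> \<gamma>, of n] by blast
    have "Z \<subseteq> Vlevel \<beta>"
    proof
      fix z assume "z \<in> Z"
      then obtain as where "z = tup as" "length as = n" "set as \<subseteq> elts \<gamma>" using Z by blast
      then show "z \<in> Vlevel \<beta>" using \<beta>(2)[of as] \<gamma>V by blast
    qed
    then show ?thesis using vset_in_Vlevel[OF _ \<beta>(1)] small_subset[OF small_Vlevel] by blast
  qed
  have R: "vset (R r) \<in> Vlevel \<alpha> \<and> small (R r)" for r
    by (rule code[of _ "rel_arity \<tau> r"]) (auto simp: R_def)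
  have F: "vset (F f) \<in> Vlevel \<alpha> \<and> small (F f)" for f
  proof (rule code[of _ "Suc (fun_arity \<tau> f)"])
    fix z assume "z \<in> F f"
    then obtain v as where "z = tup (v # as)" "length as = fun_arity \<tau> f" "set as \<subseteq> elts \<gamma>" "v \<in> elts \<gamma>"
      unfolding F_def by blast
    then show "\<exists>as. z = tup as \<and> length as = Suc (fun_arity \<tau> f) \<and> set as \<subseteq> elts \<gamma>"
      by (intro exI[of _ "v # as"]) simp
  qed
  have "\<gamma> \<in> Vlevel \<alpha>" using Ord_subset_Vlevel[OF Ord] \<gamma> by blast
  then have "range G \<subseteq> Vlevel \<alpha>" using R F by (auto simp: G_def split: idx.split)
  moreover have "tup as \<in> R r \<longleftrightarrow> rel_int S r (map h as)"
    if "length as = rel_arity \<tau> r" "set as \<subseteq> elts \<gamma>" for r as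
    using that by (auto simp: R_def)
  moreover have "kpair v (tup as) \<in> F f \<longleftrightarrow> fun_int S f (map h as) = h v"
    if "length as = fun_arity \<tau> f" "set as \<subseteq> elts \<gamma>" "v \<in> elts \<gamma>" for f as v
    using that by (auto simp: F_def)
  ultimately have "represents \<tau> (Vlevel \<alpha>) G h S"
    using insert_closed_Vlevel[OF \<alpha>] S h R F unfolding represents_def by (auto simp: G_def)
  then show ?thesis by (intro exI[of _ G]) (simp add: G_def)
qed

text \<open>Its transfer ensures that the image under \<open>j\<close> of the graph of a function is
  again the graph of a total function, so that the definite description in
  \<open>coded_struc\<close> denotes.\<close>

definition functional :: "nat \<Rightarrow> 'v::zfc set \<Rightarrow> 'v \<Rightarrow> 'v \<Rightarrow> bool" where
  "functional n A D F \<longleftrightarrow> (\<forall>w\<in>A. is_tup n A D w \<longrightarrow> (\<exists>v\<in>A. v \<in> elts D \<and>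
     (\<exists>z\<in>A. z \<in> elts F \<and> is_kpair A z v w) \<and>
     (\<forall>v'\<in>A. v' \<in> elts D \<and> (\<exists>z\<in>A. z \<in> elts F \<and> is_kpair A z v' w) \<longrightarrow> v' = v)))"

lemma fmla_functional: "fmla (\<lambda>A e. functional n A (e d) (e f))"
  unfolding functional_def by (intro fmla_intros fmla_notions)

lemma functional_iff:
  assumes A: "insert_closed A" and D: "D \<in> A"
  shows "functional n A D F \<longleftrightarrow> (\<forall>as. length as = n \<longrightarrow> set as \<subseteq> elts D \<longrightarrow>
    (\<exists>!v. v \<in> elts D \<and> kpair v (tup as) \<in> elts F))"
proof -
  have kpair: "(\<exists>z\<in>A. z \<in> elts F \<and> is_kpair A z v w) \<longleftrightarrow> kpair v w \<in> elts F" if "v \<in> A" "w \<in> A" for v w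
    using that is_kpair_iff[OF A] kpair_closed[OF A] by auto
  have DA: "v \<in> A" if "v \<in> elts D" for v using insert_closed_elts[OF A D that] .
  have ex1: "(\<exists>v\<in>A. v \<in> elts D \<and> (\<exists>z\<in>A. z \<in> elts F \<and> is_kpair A z v w) \<and>
     (\<forall>v'\<in>A. v' \<in> elts D \<and> (\<exists>z\<in>A. z \<in> elts F \<and> is_kpair A z v' w) \<longrightarrow> v' = v)) \<longleftrightarrow>
     (\<exists>!v. v \<in> elts D \<and> kpair v w \<in> elts F)" (is "?l = _") if "w \<in> A" for w
  proof -
    have "?l \<longleftrightarrow> (\<exists>v\<in>A. v \<in> elts D \<and> kpair v w \<in> elts F \<and>
       (\<forall>v'\<in>A. v' \<in> elts D \<and> kpair v' w \<in> elts F \<longrightarrow> v' = v))"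
      using kpair[OF _ that] by simp
    also have "\<dots> \<longleftrightarrow> (\<exists>v. (v \<in> elts D \<and> kpair v w \<in> elts F) \<and>
       (\<forall>v'. v' \<in> elts D \<and> kpair v' w \<in> elts F \<longrightarrow> v' = v))"
      using DA by blast
    finally show ?thesis by (simp only: Ex1_def)
  qed
  have "functional n A D F \<longleftrightarrow>
      (\<forall>w\<in>A. is_tup n A D w \<longrightarrow> (\<exists>!v. v \<in> elts D \<and> kpair v w \<in> elts F))"
    unfolding functional_def by (intro ball_cong imp_cong refl ex1)
  also have "\<dots> \<longleftrightarrow> (\<forall>as. length as = n \<longrightarrow> set as \<subseteq> elts D \<longrightarrow>
    (\<exists>!v. v \<in> elts D \<and> kpair v (tup as) \<in> elts F))" (is "?L = ?R")
  proof
    assume L: ?L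
    show ?R
    proof (intro allI impI)
      fix as assume as: "length as = n" "set as \<subseteq> elts D"
      then have "tup as \<in> A" using DA by (intro tup_closed[OF A]) blast
      moreover from this have "is_tup n A D (tup as)" using as is_tup_iff[OF A D] by blast
      ultimately show "\<exists>!v. v \<in> elts D \<and> kpair v (tup as) \<in> elts F"
        by (intro L[rule_format])
    qed
  next
    assume R: ?R
    show ?L
    proof (intro ballI impI)
      fix w assume "w \<in> A" "is_tup n A D w"
      then obtain as where "length as = n" "set as \<subseteq> elts D" "w = tup as"
        using is_tup_iff[OF A D] by blast
      then show "\<exists>!v. v \<in> elts D \<and> kpair v w \<in> elts F" using R by simp
    qed
  qed
  finally show ?thesis .
qed

lemma represents_functional:
  assumes rep: "represents \<tau> A G h U" and f: "f \<in> elts (fun_syms \<tau>)"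
  shows "functional (fun_arity \<tau> f) A (G Dom) (G (FS f))"
  unfolding functional_iff[OF represents_closed[OF rep] represents_par[OF rep]]
proof (intro allI impI)
  fix as assume as: "length as = fun_arity \<tau> f" "set as \<subseteq> elts (G Dom)"
  have "set (map h as) \<subseteq> elts (dom U)"
    using as(2) bij_betwE[OF represents_bij[OF rep]] by auto
  then have "fun_int U f (map h as) \<in> elts (dom U)"
    using represents_struc[OF rep] f as(1) unfolding is_struc_def by simp
  then obtain v where v: "v \<in> elts (G Dom)" "fun_int U f (map h as) = h v"
    using represents_bij[OF rep] by (auto simp: bij_betw_def)
  then show "\<exists>!v. v \<in> elts (G Dom) \<and> kpair v (tup as) \<in> elts (G (FS f))"
    using represents_fun[OF rep f as] represents_inj[OF rep] by metis
qed

text \<open>By foundation, no set \<open>{d, x}\<close> is an element of \<open>d\<close>; these sets are the new elements of the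
  extension.\<close>
lemma exists_inj_extension:
  fixes d :: "'v::zfc" and A B :: "'v set"
  assumes j: "inj_on j A" "j ` A \<subseteq> B" and h: "bij_betw h A (elts d)"
  obtains k where "inj_on k B" "\<And>a. a \<in> A \<Longrightarrow> k (j a) = h a"
proof -
  define k where "k b = (if b \<in> j ` A then h (inv_into A j b) else vset {d, b})" for b
  have kj: "k (j a) = h a" if "a \<in> A" for a using that j by (simp add: k_def)
  have new: "vset {d, b} \<notin> elts d" for b using mem_asym[of d "vset {d, b}"] by auto
  have "inj_on k B"
  proof (rule inj_onI)
    fix b c assume eq: "k b = k c"
    have old: "b \<in> j ` A \<longleftrightarrow> k b \<in> elts d" for b
      using kj bij_betwE[OF h] new by (cases "b \<in> j ` A") (auto simp: k_def)
    show "b = c"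
    proof (cases "b \<in> j ` A")
      case True
      then obtain a a' where "b = j a" "c = j a'" "a \<in> A" "a' \<in> A" using old eq by (metis imageE)
      then show ?thesis using eq kj h by (auto simp: bij_betw_def inj_on_def)
    next
      case False
      then have "vset {d, b} = vset {d, c}" using old eq unfolding k_def by metis
      then show ?thesis by (auto simp: vset_inject doubleton_eq_iff)
    qed
  qed
  then show ?thesis using kj that by blast
qed

section \<open>The extension and the bound on the number\<close>

lemma SULST_property_LI:
  fixes \<kappa> \<delta> :: "'v::zfc"
  assumes "cc_extendible_pushing_up \<kappa> \<delta>"
  shows "SULST_property LI_elementary_substructure \<delta>"
  unfolding SULST_property_def
proof (intro allI impI, elim conjE)
  fix \<tau> S \<gamma> \<gamma>'
  assume S: "is_struc \<tau> S" "has_size (dom S) \<gamma>" and \<delta>\<gamma>: "\<delta> \<le>\<^sub>o \<gamma>" and \<gamma>': "Card \<gamma>'" "\<gamma> <\<^sub>o \<gamma>'"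
  obtain \<alpha> where \<alpha>: "limit_Ord \<alpha>" "\<gamma>' \<in> elts \<alpha>" using limit_Ord_above[of \<gamma>'] \<gamma>'(1) by (auto simp: Card_def)
  then have Ord: "Ord \<alpha>" by (simp add: limit_Ord_def)
  have \<gamma>: "\<gamma> \<in> elts \<alpha>" using Ord_trans[OF Ord \<alpha>(2) \<gamma>'(2)] .
  have \<delta>: "\<delta> \<in> elts \<alpha>" using \<delta>\<gamma> \<gamma> Ord_trans[OF Ord \<gamma>] by blast
  have Card\<gamma>: "Card \<gamma>" using S(2) by (simp add: has_size_def)
  let ?A = "Vlevel \<alpha>"
  obtain j M where M: "transitive_set M" "cardinal_correct M" and j: "elementary_embedding j ?A (elts M)"
    and push: "\<alpha> \<in> elts (j \<delta>)"
    using assms Ord \<delta> unfolding cc_extendible_pushing_up_def by blast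
  let ?B = "elts M"
  have closed: "insert_closed ?A" using insert_closed_Vlevel[OF \<alpha>(1)] .
  have closedM: "insert_closed ?B" using elementary_insert_closed[OF j closed M(1)] .
  have jM: "j x \<in> ?B" if "x \<in> ?A" for x using j that by (auto simp: elementary_embedding_def)
  have j_mem: "x \<in> elts y \<longleftrightarrow> j x \<in> elts (j y)" if "x \<in> ?A" "y \<in> ?A" for x y
    using fmla_transfer[OF j fmla_mem[of False True], of "case_bool y x"] that
    by (auto split: bool.splits)
  have j_eq: "x = y \<longleftrightarrow> j x = j y" if "x \<in> ?A" "y \<in> ?A" for x y
    using fmla_transfer[OF j fmla_eq[of False True], of "case_bool y x"] that
    by (auto split: bool.splits)
  have \<gamma>A: "\<gamma> \<in> ?A" "elts \<gamma> \<subseteq> ?A" "\<delta> \<in> ?A"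
    using Ord_subset_Vlevel[OF Ord] \<gamma> \<delta> Ord_trans[OF Ord \<gamma>] by auto
  obtain h where h: "bij_betw h (elts \<gamma>) (elts (dom S))"
    using S(2) by (auto simp: has_size_def eqpoll_def dest: bij_betw_inv_into)
  obtain G where G: "G Dom = \<gamma>" and rep: "represents \<tau> ?A G h S"
    using exists_representation[OF \<alpha>(1) \<gamma> S(1) h] by blast
  let ?G = "j \<circ> G"
  have "inj_on j (elts \<gamma>)" using j_eq \<gamma>A(2) by (auto simp: inj_on_def)
  moreover have j\<gamma>: "j ` elts \<gamma> \<subseteq> elts (j \<gamma>)" using j_mem \<gamma>A by blast
  \<comment> \<open>\<open>S\<close> has to be literally contained in \<open>T\<close>, whereas
    \<open>j\<close> only embeds its copy. So \<open>k\<close> renames \<open>j a\<close> back to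
    \<open>h a\<close> and gives new names to the rest of \<open>j \<gamma>\<close>.\<close>
  ultimately obtain k where k: "inj_on k (elts (j \<gamma>))" "\<And>a. a \<in> elts \<gamma> \<Longrightarrow> k (j a) = h a"
    using exists_inj_extension[OF _ _ h] by blast
  have ne: "elts \<gamma> \<noteq> {}" using S(1) h by (auto simp: is_struc_def bij_betw_def)
  define T where "T = coded_struc ?G k"
  have G_range: "range G \<subseteq> ?A" using represents_par[OF rep] by blast
  have repT: "represents \<tau> ?B ?G k T"
    unfolding T_def
  proof (rule represents_coded_struc[OF closedM])
    show "range ?G \<subseteq> ?B" using G_range jM by auto
    show "inj_on k (elts (?G Dom))" using k(1) G by simp
    show "elts (?G Dom) \<noteq> {}" using G ne j\<gamma> by auto
    fix f as assume f: "f \<in> elts (fun_syms \<tau>)" and as: "length as = fun_arity \<tau> f" "set as \<subseteq> elts (?G Dom)"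
    have "functional (fun_arity \<tau> f) ?B (?G Dom) (?G (FS f))"
      using fmla_transfer[OF j fmla_functional[of _ Dom "FS f"], of G] represents_functional[OF rep f]
        represents_par[OF rep] by simp
    then show "\<exists>!v. v \<in> elts (?G Dom) \<and> kpair v (tup as) \<in> elts (?G (FS f))"
      using functional_iff[OF closedM, of "?G Dom"] jM[OF represents_par[OF rep]] as by auto
  qed
  have domT: "elts (dom T) = k ` elts (j \<gamma>)" by (simp add: T_def coded_struc_def G)
  have "LI_elementary_substructure \<tau> S T"
  proof (rule LI_elementary_substructureI[OF S(1) represents_struc[OF repT]])
    show "elts (dom S) \<subseteq> elts (dom T)"
    proof
      fix b assume "b \<in> elts (dom S)"
      then obtain a where "a \<in> elts \<gamma>" "b = h a" using h by (auto simp: bij_betw_def)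
      then show "b \<in> elts (dom T)" using k(2) j\<gamma> domT by force
    qed
    fix \<phi> and s :: "nat \<Rightarrow> 'v" assume \<phi>: "is_fm \<tau> \<phi>" and s: "range s \<subseteq> elts (dom S)"
    obtain Q where Q: "fmla Q" "expresses ?A G h S Q \<phi>" "expresses ?B ?G k T Q \<phi>"
      using exists_expresses[OF j correct_class_Vlevel[OF \<alpha>(1)] correct_class_elts[OF closedM M(2)]
          rep repT _ \<phi>] Vlevel_subsets_have_Card[OF \<alpha>(1) \<gamma>] G by metis
    define s0 where "s0 n = inv_into (elts \<gamma>) h (s n)" for n
    have s0: "s0 n \<in> elts \<gamma>" "h (s0 n) = s n" for n
      using s h by (auto simp: s0_def bij_betw_def range_subsetD inv_into_into f_inv_into_f)
    have r0: "range s0 \<subseteq> elts (G Dom)" using s0 G by auto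
    have "sat S \<phi> s \<longleftrightarrow> sat S \<phi> (h \<circ> s0)" using s0 by (simp add: comp_def)
    also have "\<dots> \<longleftrightarrow> Q ?A (env G s0)" using Q(2) r0 by (simp add: expresses_def)
    \<comment> \<open>The common translation is a first-order formula and the pulled-back parameters
      are elements of \<gamma>, so one application of elementarity passes from \<open>S\<close> to
      \<open>T\<close>.\<close>
    also have "\<dots> \<longleftrightarrow> Q ?B (env ?G (j \<circ> s0))"
      unfolding env_comp using env_mem[OF G_range] s0 \<gamma>A(2) by (intro fmla_transfer[OF j Q(1)]) blast
    also have "\<dots> \<longleftrightarrow> sat T \<phi> (k \<circ> (j \<circ> s0))"
    proof -
      have "range (j \<circ> s0) \<subseteq> elts (?G Dom)" using s0 j\<gamma> G by auto
      then show ?thesis using Q(3) unfolding expresses_def by blast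
    qed
    also have "k \<circ> (j \<circ> s0) = s" using k(2) s0 by (auto simp: fun_eq_iff)
    finally show "sat S \<phi> s \<longleftrightarrow> sat T \<phi> s" .
  qed
  moreover have "has_size (dom T) (j \<gamma>)"
  proof -
    have "is_Card ?A \<gamma>" using Card_imp_is_Card[OF closed \<gamma>A(1) Card\<gamma>] .
    then have "is_Card ?B (j \<gamma>)"
      using fmla_transfer[OF j fmla_is_Card[of "()"], of "\<lambda>_. \<gamma>"] \<gamma>A(1) by simp
    then have "Card (j \<gamma>)"
      using correct_class_elts[OF closedM M(2)] jM[OF \<gamma>A(1)] by (simp add: correct_class_def)
    moreover have "elts (j \<gamma>) \<approx> elts (dom T)"
      using k(1) domT unfolding eqpoll_def bij_betw_def by metis
    ultimately show ?thesis unfolding has_size_def using eqpoll_sym by blast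
  qed
  moreover have "\<gamma>' \<in> elts (j \<gamma>)"
  proof -
    have "Ord (j \<gamma>)" using \<open>has_size (dom T) (j \<gamma>)\<close> by (simp add: has_size_def Card_def)
    \<comment> \<open>\<open>j\<close> preserves membership, so \<delta> being an element of or
      equal to \<gamma> gives the same for their images, and the ordinal \<open>j \<gamma>\<close>
      is transitive.\<close>
    moreover have "\<alpha> \<in> elts (j \<gamma>)"
      using push \<delta>\<gamma> j_mem[OF \<gamma>A(3) \<gamma>A(1)] Ord_trans[OF \<open>Ord (j \<gamma>)\<close>] by blast
    ultimately show ?thesis using Ord_trans \<alpha>(2) by blast
  qed
  ultimately show "\<exists>T \<mu>. is_struc \<tau> T \<and> has_size (dom T) \<mu> \<and> \<gamma>' \<le>\<^sub>o \<mu> \<and> LI_elementary_substructure \<tau> S T"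
    using represents_struc[OF repT] by blast
qed

lemma is_SULST_exists:
  fixes \<delta> :: "'v::zfc"
  assumes "Card \<delta>" "SULST_property E \<delta>"
  shows "\<exists>\<mu>. is_SULST E \<mu> \<and> \<mu> \<le>\<^sub>o \<delta>"
proof -
  let ?Q = "{\<mu> :: 'v. Card \<mu> \<and> SULST_property E \<mu>}"
  have "\<delta> \<in> ?Q" using assms by simp
  then have "\<exists>\<mu>\<in>?Q. \<forall>\<nu>\<in>elts \<mu>. \<nu> \<notin> ?Q" by (rule mem_minimal)
  then obtain \<mu> where \<mu>: "Card \<mu>" "SULST_property E \<mu>" "\<forall>\<nu>\<in>elts \<mu>. \<nu> \<notin> ?Q" by auto
  have "\<mu> \<le>\<^sub>o \<nu>" if "Card \<nu>" "SULST_property E \<nu>" for \<nu>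
    using Ord_linear[of \<mu> \<nu>] \<mu> that by (auto simp: Card_def)
  then show ?thesis using \<mu> assms by (auto simp: is_SULST_def)
qed

theorem theorem11p1:
  fixes \<kappa> \<delta> :: "'v::zfc"
  assumes "Card \<kappa>" and "Card \<delta>" and "\<kappa> \<le>\<^sub>o \<delta>"
    and "cc_extendible_pushing_up \<kappa> \<delta>"
  shows "\<exists>\<mu>. is_SULST LI_elementary_substructure \<mu> \<and> \<mu> \<le>\<^sub>o \<delta>"
  using is_SULST_exists[OF assms(2) SULST_property_LI[OF assms(4)]] .

end
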